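(* Let $\mathcal{S}$ be a finite left regular band of abelian groups, let $\{\mathfrak{u}_X\}_{X\in E(\mathcal{T})}$ be a homogeneous section with associated idempotents $\{\mathfrak{e}^\circ_X\}$, and let $\mathbf{Q}^\circ_x=\mathbf{H}_x\mathfrak{e}^\circ_{\mathsf{supp}(x)}$ for $x\in E(\mathcal{S})$. For $\phi\in\widehat{\mathcal{S}}$ and $\Phi\in\widehat{\mathcal{T}}$ define $$\mathbf{Q}_\phi:=\mathbf{E}_\phi\mathbf{Q}^\circ_{|\phi|},\qquad \mathfrak{e}_\Phi:=\mathfrak{u}_{\mathsf{supp}(|\phi|)}\mathbf{Q}_\phi\ \text{ for any }\phi\text{ with }\mathsf{supp}(\phi)=\Phi.$$ Then $\{\mathbf{Q}_\phi\}_{\phi\in\widehat{\mathcal{S}}}$ is a basis of $\mathbb{C}\mathcal{S}$ consisting of primitive idempotents, and $\{\mathfrak{e}_\Phi\}_{\Phi\in\widehat{\mathcal{T}}}$ is a complete system of primitive orthogonal idempotents of $\mathbb{C}\mathcal{S}$.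
   Context: All semigroups are finite; $s^\omega$ is the idempotent positive power of $s$. A left regular band of groups (LRBG) is a finite semigroup with $s^\omega s=s$ and $sts^\omega=st$ for all $s,t$. $E(\mathcal{S})$ is the set of idempotents (a left regular band). $G_x=\{s: s^\omega=x\}$ for $x\in E(\mathcal{S})$ is a group with identity $x$; $\mathcal{S}$ is a left regular band of abelian groups if every $G_x$ is abelian. $s\sim t$ iff $s^\omega t=s$ and $t^\omega s=t$ (a congruence); $\mathcal{T}=\mathcal{S}/\!\sim$, $\mathsf{supp}$ the quotient map; $E(\mathcal{T})=\mathsf{supp}(E(\mathcal{S}))$ ordered by $X\le Y$ iff $XY=Y$. $\mathbb{C}\mathcal{S}$ has basis $\mathbf{H}_s$ with $\mathbf{H}_s\mathbf{H}_t=\mathbf{H}_{st}$. A homogeneous section is $\{\mathfrak{u}_X\}$ with $\mathfrak{u}_X=\sum_{x\in E(\mathcal{S}),\mathsf{supp}(x)=X}c_x\mathbf{H}_x$, $\sum c_x=1$; $\mathfrak{e}^\circ_X:=\mathfrak{u}_X-\sum_{Y>X}\mathfrak{u}_X\mathfrak{e}^\circ_Y$ recursively (a complete system of primitive orthogonal idempotents of $\mathbb{C}E(\mathcal{S})$). For $x,y\in E(\mathcal{S})$, $\lambda_{y,x}:G_x\to G_{yx}$, $s\mapsto ys$, is a group morphism. $\widehat{\mathcal{S}}=\bigsqcup_{x\in E(\mathcal{S})}\widehat{G_x}$ with $\widehat{G_x}=\mathrm{Hom}(G_x,\mathbb{C}^\times)$; for $\phi\in\widehat{G_x}$, $|\phi|:=x$.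 $\phi\sim\psi$ iff $|\phi|\sim|\psi|$ and $\phi=\psi\circ\lambda_{|\psi|,|\phi|}$; $\widehat{\mathcal{T}}=\widehat{\mathcal{S}}/\!\sim$ with class map $\mathsf{supp}$. $\mathbf{E}_\phi=\frac{1}{|G_{|\phi|}|}\sum_{s\in G_{|\phi|}}\overline{\phi(s)}\mathbf{H}_s$. (The element $\mathfrak{e}_\Phi$ does not depend on the choice of $\phi$.) *)

theory Defs
  imports "HOL-Analysis.Analysis"
begin

section \<open>Left regular bands of groups\<close>

text \<open>
  The idempotent positive power \<open>s\<^sup>\<omega>\<close>. A semigroup has no power operation in the library (there
  is no unit); \<open>((*) s ^^ n) s\<close> is the product of \<open>n + 1\<close> copies of \<open>s\<close>.
\<close>

definition (in semigroup_mult) omega :: "'a \<Rightarrow> 'a"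
  where "omega s = (THE e. e * e = e \<and> (\<exists>n. e = ((*) s ^^ n) s))"

class left_regular_band_of_groups = semigroup_mult + finite +
  assumes omega_mult_self: "omega s * s = s"
    and mult_mult_omega: "s * t * omega s = s * t"

definition Idem :: "'a::semigroup_mult set"
  where "Idem = {x. x * x = x}"

definition max_subgroup :: "'a::semigroup_mult \<Rightarrow> 'a set"
  where "max_subgroup x = {s. omega s = x}"

class left_regular_band_of_abelian_groups = left_regular_band_of_groups +
  assumes max_subgroup_commute:
    "x * x = x \<Longrightarrow> omega s = x \<Longrightarrow> omega t = x \<Longrightarrow> s * t = t * s"


section \<open>Supports\<close>

definition sim :: "'a::semigroup_mult \<Rightarrow> 'a \<Rightarrow> bool"
  where "sim s t \<longleftrightarrow> omega s * t = s \<and> omega t * s = t"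

definition supp :: "'a::semigroup_mult \<Rightarrow> 'a set"
  where "supp s = {(s, t). sim s t} `` {s}"

text \<open>The product induced on the quotient by the congruence \<^const>\<open>sim\<close>.\<close>

definition supp_mult :: "'a::semigroup_mult set \<Rightarrow> 'a set \<Rightarrow> 'a set"
  where "supp_mult X Y = (\<Union>s\<in>X. \<Union>t\<in>Y. supp (s * t))"

definition Idem_supp :: "'a::semigroup_mult set set"
  where "Idem_supp = supp ` Idem"

definition supp_le :: "'a::semigroup_mult set \<Rightarrow> 'a set \<Rightarrow> bool"
  where "supp_le X Y \<longleftrightarrow> supp_mult X Y = Y"

definition supp_less :: "'a::semigroup_mult set \<Rightarrow> 'a set \<Rightarrow> bool"
  where "supp_less X Y \<longleftrightarrow> supp_le X Y \<and> X \<noteq> Y"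


subsection \<open>The order on idempotent supports\<close>

lemma omega_Idem:
  assumes "x \<in> Idem" shows "omega x = x"
proof -
  have x: "x * x = x" using assms by (simp add: Idem_def)
  have "((*) x ^^ n) x = x" for n
    by (induction n) (simp_all add: x)
  then show ?thesis unfolding omega_def by (intro the_equality) (auto simp: x)
qed

lemma Idem_lrb:
  fixes x y :: "'a::left_regular_band_of_groups"
  assumes "x \<in> Idem" shows "x * y * x = x * y"
  using mult_mult_omega[of x y] omega_Idem[OF assms] by simp

lemma Idem_mult:
  fixes x y :: "'a::left_regular_band_of_groups"
  assumes "x \<in> Idem" "y \<in> Idem" shows "x * y \<in> Idem"
proof -
  have "x * y * (x * y) = x * y * x * y" by (simp only: mult.assoc)
  also have "\<dots> = x * y * y" by (simp only: Idem_lrb[OF assms(1)])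
  also have "\<dots> = x * y" using assms(2) by (simp add: Idem_def mult.assoc)
  finally show ?thesis by (simp add: Idem_def)
qed

lemma sim_Idem_iff:
  assumes "x \<in> Idem" "y \<in> Idem" shows "sim x y \<longleftrightarrow> x * y = x \<and> y * x = y"
  using assms by (simp add: sim_def omega_Idem)

lemma sim_Idem:
  fixes x s :: "'a::left_regular_band_of_groups"
  assumes "x \<in> Idem" "sim x s" shows "s \<in> Idem"
proof -
  have a: "x * s = x" "omega s * x = s"
    using assms by (simp_all add: sim_def omega_Idem)
  have "s * s = omega s * x * s" by (simp add: a)
  also have "\<dots> = omega s * (x * s)" by (simp add: mult.assoc)
  also have "\<dots> = s" by (simp add: a)
  finally show ?thesis by (simp add: Idem_def)
qed

lemma mem_supp_Idem:
  fixes x y :: "'a::left_regular_band_of_groups"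
  assumes "x \<in> Idem"
  shows "y \<in> supp x \<longleftrightarrow> y \<in> Idem \<and> x * y = x \<and> y * x = y"
  using assms sim_Idem sim_Idem_iff by (auto simp: supp_def)

lemma supp_Idem_eq_iff:
  fixes x y :: "'a::left_regular_band_of_groups"
  assumes "x \<in> Idem" "y \<in> Idem"
  shows "supp x = supp y \<longleftrightarrow> x * y = x \<and> y * x = y"
proof
  assume "supp x = supp y"
  moreover have "y \<in> supp y"
    unfolding mem_supp_Idem[OF assms(2)] using assms(2) by (simp add: Idem_def)
  ultimately have "y \<in> supp x" by blast
  then show "x * y = x \<and> y * x = y" unfolding mem_supp_Idem[OF assms(1)] by blast
next
  assume h: "x * y = x \<and> y * x = y"
  have *: "b * z = b \<and> z * b = z"
    if "a * b = a" "b * a = b" "a * z = a" "z * a = z" for a b z :: 'a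
  proof
    have "b * z = b * (a * z)" by (simp only: mult.assoc[symmetric] that(2))
    then show "b * z = b" by (simp only: that)
    have "z * b = z * (a * b)" by (simp only: mult.assoc[symmetric] that(4))
    then show "z * b = z" by (simp only: that)
  qed
  have "z \<in> supp x \<longleftrightarrow> z \<in> supp y" for z
    unfolding mem_supp_Idem[OF assms(1)] mem_supp_Idem[OF assms(2)]
    using h *[of x y z] *[of y x z] by blast
  then show "supp x = supp y" by blast
qed

lemma supp_mult_Idem:
  fixes x y :: "'a::left_regular_band_of_groups"
  assumes x: "x \<in> Idem" and y: "y \<in> Idem"
  shows "supp_mult (supp x) (supp y) = supp (x * y)"
proof -
  have *: "supp (s * t) = supp (x * y)" if s: "s \<in> supp x" and t: "t \<in> supp y" for s t
  proof -
    have s': "s \<in> Idem" "x * s = x" "s * x = s" using s x by (simp_all add: mem_supp_Idem)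
    have t': "t \<in> Idem" "y * t = y" "t * y = t" using t y by (simp_all add: mem_supp_Idem)
    have 1: "s * t * (x * y) = s * t"
    proof -
      have "s * t * (x * y) = s * t * s * (x * y)" using Idem_lrb[OF s'(1)] by simp
      also have "\<dots> = s * t * (s * x) * y" by (simp add: mult.assoc)
      also have "\<dots> = s * t * s * y" by (simp add: s')
      also have "\<dots> = s * t * y" using Idem_lrb[OF s'(1)] by simp
      also have "\<dots> = s * t" by (simp add: mult.assoc t')
      finally show ?thesis .
    qed
    have 2: "x * y * (s * t) = x * y"
    proof -
      have "x * y * (s * t) = x * y * x * (s * t)" using Idem_lrb[OF x] by simp
      also have "\<dots> = x * y * (x * s) * t" by (simp add: mult.assoc)
      also have "\<dots> = x * y * x * t" by (simp add: s')
      also have "\<dots> = x * y * t" using Idem_lrb[OF x] by simp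
      also have "\<dots> = x * y" by (simp add: mult.assoc t')
      finally show ?thesis .
    qed
    show ?thesis
      using 1 2 Idem_mult[OF s'(1) t'(1)] Idem_mult[OF x y] by (simp add: supp_Idem_eq_iff)
  qed
  have self: "x \<in> supp x" "y \<in> supp y"
    unfolding mem_supp_Idem[OF x] mem_supp_Idem[OF y] using x y by (auto simp: Idem_def)
  have "(\<Union>t\<in>supp y. supp (s * t)) = supp (x * y)" if "s \<in> supp x" for s
    using *[OF that] self(2) by blast
  then show ?thesis unfolding supp_mult_def using self(1) by blast
qed

lemma supp_le_Idem_iff:
  fixes x y :: "'a::left_regular_band_of_groups"
  assumes "x \<in> Idem" "y \<in> Idem"
  shows "supp_le (supp x) (supp y) \<longleftrightarrow> y * x = y"
proof -
  have "x * y * y = x * y" using assms(2) by (simp add: Idem_def mult.assoc)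
  moreover have "y * (x * y) = y * x" using Idem_lrb[OF assms(2), of x] by (simp add: mult.assoc)
  ultimately show ?thesis
    unfolding supp_le_def
    using supp_mult_Idem[OF assms] supp_Idem_eq_iff[OF Idem_mult[OF assms] assms(2)] by simp
qed

lemma supp_less_trans:
  fixes X Y Z :: "'a::left_regular_band_of_groups set"
  assumes "X \<in> Idem_supp" "Y \<in> Idem_supp" "Z \<in> Idem_supp" "supp_less X Y" "supp_less Y Z"
  shows "supp_less X Z"
proof -
  from assms(1-3) obtain x y z where
    e: "x \<in> Idem" "y \<in> Idem" "z \<in> Idem" and eq: "X = supp x" "Y = supp y" "Z = supp z"
    by (auto simp: Idem_supp_def)
  have h: "y * x = y" "z * y = z" "supp x \<noteq> supp y"
    using assms(4,5) e by (auto simp: supp_less_def supp_le_Idem_iff eq)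
  have 1: "z * x = z" using h by (metis mult.assoc)
  have "X \<noteq> Z"
  proof
    assume "X = Z"
    then have "x * z = x" using e by (simp add: eq supp_Idem_eq_iff)
    then have "x * y = x" using h by (metis mult.assoc)
    then show False using h e by (simp add: supp_Idem_eq_iff)
  qed
  then show ?thesis using 1 e by (simp add: supp_less_def eq supp_le_Idem_iff)
qed


section \<open>The semigroup algebra\<close>

text \<open>
  The underlying vector space of the semigroup algebra is \<open>complex ^ 'a\<close> with scalar multiplication
  \<^term>\<open>(*s)\<close>. Its product is \<open>\<star>\<close> below; the library product \<open>*\<close> on \<open>complex ^ 'a\<close> is
  componentwise and is not the one of the algebra.
\<close>

type_synonym 'a alg = "(complex, 'a) vec"

definition H :: "'a::finite \<Rightarrow> 'a alg"
  where "H s = axis s 1"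

definition alg_mult :: "'a alg \<Rightarrow> 'a alg \<Rightarrow> ('a::{semigroup_mult,finite}) alg"
    (infixl \<open>\<star>\<close> 70)
  where "f \<star> g = (\<Sum>s\<in>UNIV. \<Sum>t\<in>UNIV. (f $ s * g $ t) *s H (s * t))"

definition primitive_idempotent :: "('a::{semigroup_mult,finite}) alg \<Rightarrow> bool"
  where "primitive_idempotent e \<longleftrightarrow> e \<noteq> 0 \<and> e \<star> e = e \<and>
    (\<forall>f g. f \<star> f = f \<longrightarrow> g \<star> g = g \<longrightarrow> f \<star> g = 0 \<longrightarrow> g \<star> f = 0 \<longrightarrow> e = f + g \<longrightarrow>
      f = 0 \<or> g = 0)"

text \<open>
  The algebra of a left regular band of groups always has a right identity, but it need not have a
  two-sided one: in a left zero band every element is a right identity. Completeness of a system of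
  idempotents is therefore stated as: the sum of the system is a right identity. If the algebra is
  unital, this says exactly that the sum is \<open>1\<close> (lemma \<open>complete_unital_iff\<close> below); in general
  it implies that no nonzero idempotent is orthogonal to the whole system.
\<close>

definition complete_primitive_orthogonal ::
    "'i set \<Rightarrow> ('i \<Rightarrow> ('a::{semigroup_mult,finite}) alg) \<Rightarrow> bool"
  where "complete_primitive_orthogonal I e \<longleftrightarrow>
    (\<forall>i\<in>I. primitive_idempotent (e i)) \<and>
    (\<forall>i\<in>I. \<forall>j\<in>I. i \<noteq> j \<longrightarrow> e i \<star> e j = 0) \<and>
    (\<forall>a. a \<star> (\<Sum>i\<in>I. e i) = a)"

lemma complete_unital_iff:
  assumes "\<forall>a. one \<star> a = a \<and> a \<star> one = a"
  shows "(\<forall>a. a \<star> f = a) \<longleftrightarrow> f = one"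
  using assms by metis

definition is_basis_family :: "'i set \<Rightarrow> ('i \<Rightarrow> complex ^ 'n) \<Rightarrow> bool"
  where "is_basis_family I b \<longleftrightarrow>
    inj_on b I \<and> vec.independent (b ` I) \<and> vec.span (b ` I) = UNIV"


section \<open>Homogeneous sections and the associated idempotents\<close>

definition homogeneous_section ::
    "('a::{semigroup_mult,finite} set \<Rightarrow> 'a alg) \<Rightarrow> bool"
  where "homogeneous_section u \<longleftrightarrow>
    (\<forall>X\<in>Idem_supp. \<exists>c::'a \<Rightarrow> complex.
      (\<Sum>x | x \<in> Idem \<and> supp x = X. c x) = 1 \<and>
      u X = (\<Sum>x | x \<in> Idem \<and> supp x = X. c x *s H x))"

text \<open>
  The guard only serves to make the recursion total; the value is meaningful for
  \<open>X \<in> Idem_supp\<close>, where \<open>e_circ_rec\<close> below is the recursion.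
\<close>

function e_circ :: "('a::left_regular_band_of_groups set \<Rightarrow> 'a alg) \<Rightarrow> 'a set \<Rightarrow> 'a alg"
  where "e_circ u X =
    (if X \<in> Idem_supp
     then u X - (\<Sum>Y | Y \<in> Idem_supp \<and> supp_less X Y. u X \<star> e_circ u Y)
     else 0)"
  by pat_completeness auto
termination
proof (relation "Wellfounded.measure (\<lambda>(u, X). card {Z \<in> Idem_supp. supp_less X Z})")
  fix u :: "'a set \<Rightarrow> 'a alg" and X Y :: "'a set"
  assume X: "X \<in> Idem_supp" and "Y \<in> {Y \<in> Idem_supp. supp_less X Y}"
  then have Y: "Y \<in> Idem_supp" "supp_less X Y" by auto
  have "{Z \<in> Idem_supp. supp_less Y Z} \<subset> {Z \<in> Idem_supp. supp_less X Z}"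
  proof
    show "{Z \<in> Idem_supp. supp_less Y Z} \<subseteq> {Z \<in> Idem_supp. supp_less X Z}"
      using supp_less_trans[OF X Y(1) _ Y(2)] by blast
    have "\<not> supp_less Y Y" by (simp add: supp_less_def)
    then show "{Z \<in> Idem_supp. supp_less Y Z} \<noteq> {Z \<in> Idem_supp. supp_less X Z}"
      using Y by blast
  qed
  then show "((u, Y), (u, X)) \<in> Wellfounded.measure (\<lambda>(u, X). card {Z \<in> Idem_supp. supp_less X Z})"
    using psubset_card_mono[OF finite] by simp
qed simp

declare e_circ.simps [simp del]

lemma e_circ_rec:
  assumes "X \<in> Idem_supp"
  shows "e_circ u X = u X - (\<Sum>Y | Y \<in> Idem_supp \<and> supp_less X Y. u X \<star> e_circ u Y)"
  using assms by (subst e_circ.simps) simp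

definition Q_circ :: "('a::left_regular_band_of_groups set \<Rightarrow> 'a alg) \<Rightarrow> 'a \<Rightarrow> 'a alg"
  where "Q_circ u x = H x \<star> e_circ u (supp x)"


section \<open>Characters\<close>

definition characters :: "'a::semigroup_mult \<Rightarrow> ('a \<Rightarrow> complex) set"
  where "characters x = {\<phi> \<in> max_subgroup x \<rightarrow>\<^sub>E UNIV - {0}.
    \<forall>s\<in>max_subgroup x. \<forall>t\<in>max_subgroup x. \<phi> (s * t) = \<phi> s * \<phi> t}"

text \<open>
  A character \<open>\<phi>\<close> of the group at \<open>x\<close> is recorded as the pair \<open>(x, \<phi>)\<close>, so that \<open>|\<phi>|\<close> is
  the first component.
\<close>

definition S_hat :: "('a::semigroup_mult \<times> ('a \<Rightarrow> complex)) set"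
  where "S_hat = Sigma Idem characters"

definition char_sim ::
    "(('a::semigroup_mult \<times> ('a \<Rightarrow> complex)) \<times> ('a \<times> ('a \<Rightarrow> complex))) set"
  where "char_sim = {((x, \<phi>), (y, \<psi>)).
    (x, \<phi>) \<in> S_hat \<and> (y, \<psi>) \<in> S_hat \<and> sim x y \<and> \<phi> = compose (max_subgroup x) \<psi> ((*) y)}"

definition T_hat :: "('a::semigroup_mult \<times> ('a \<Rightarrow> complex)) set set"
  where "T_hat = S_hat // char_sim"

definition E_char :: "'a \<times> ('a \<Rightarrow> complex) \<Rightarrow> ('a::{semigroup_mult,finite}) alg"
  where "E_char = (\<lambda>(x, \<phi>).
    (1 / of_nat (card (max_subgroup x))) *s (\<Sum>s\<in>max_subgroup x. cnj (\<phi> s) *s H s))"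

definition Q_char :: "('a set \<Rightarrow> 'a alg) \<Rightarrow> 'a \<times> ('a \<Rightarrow> complex) \<Rightarrow>
    ('a::left_regular_band_of_groups) alg"
  where "Q_char u \<phi> = E_char \<phi> \<star> Q_circ u (fst \<phi>)"

text \<open>
  The value \<open>u (supp |\<phi>|) \<star> Q \<phi>\<close> common to all \<open>\<phi>\<close> in the class \<open>\<Phi>\<close>.
\<close>

definition e_char :: "('a set \<Rightarrow> 'a alg) \<Rightarrow> ('a \<times> ('a \<Rightarrow> complex)) set \<Rightarrow>
    ('a::left_regular_band_of_groups) alg"
  where "e_char u \<Phi> = the_elem ((\<lambda>\<phi>. u (supp (fst \<phi>)) \<star> Q_char u \<phi>) ` \<Phi>)"

end

theory Submission
  imports Defs
begin

text \<open>
  Call \<open>supp (omega t)\<close> the level of \<open>t\<close>. The map \<open>omega\<close> is not multiplicative, but levels are,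
  and \<open>x * t\<close> lies in the group at \<open>x\<close> as soon as the level of \<open>t\<close> is at most \<open>supp x\<close>. The element
  \<open>e_circ u X\<close> is killed from the left by all \<open>H t\<close> whose level is not below \<open>X\<close>, and so is the left
  ideal it generates; on this ideal \<open>e_circ u X\<close> acts from the left as \<open>u X\<close>. As \<open>E \<phi>\<close> absorbs
  \<open>u (supp |\<phi>|)\<close> from the right, \<open>Q \<phi>\<close> acts there as \<open>E \<phi>\<close>. Hence \<open>Q \<phi>\<close> is idempotent, every
  corner \<open>Q \<phi> \<star> a \<star> Q \<phi>\<close> is a scalar multiple of \<open>Q \<phi>\<close>, and orthogonality of the \<open>e \<Phi>\<close>
  reduces to that of characters. Spanning and completeness both come from \<open>\<Sum>X. e_circ u X\<close> being a
  right identity and from \<open>\<Sum>\<phi>. E (x, \<phi>) = H x\<close>. The latter identity, which is where commutativity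
  enters, is obtained by diagonalising the commuting finite-order operators \<open>H a \<star> _\<close>.
\<close>

section \<open>Idempotent powers, levels and maximal subgroups\<close>

lemma funpow_mult_mult:
  fixes s :: "'a::semigroup_mult"
  shows "((*) s ^^ m) s * ((*) s ^^ n) s = ((*) s ^^ Suc (m + n)) s"
  by (induction m) (simp_all add: mult.assoc)

text \<open>By the pigeonhole principle the powers of \<open>s\<close> are eventually periodic. An
  exponent in the periodic range that is a multiple of the period gives an idempotent.\<close>

lemma finite_semigroup_idempotent_power:
  fixes s :: "'a::{semigroup_mult,finite}"
  obtains n where "((*) s ^^ n) s \<in> Idem"
proof -
  define p where "p n = ((*) s ^^ n) s" for n
  have p_mult: "p m * p n = p (Suc (m + n))" for m n
    unfolding p_def by (rule funpow_mult_mult)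
  have "\<not> inj p"
    using finite_imageD[of p UNIV] infinite_UNIV_nat by auto
  then obtain i j where ij: "i < j" "p i = p j"
    unfolding inj_def by (metis linorder_neqE_nat)
  have step: "p (m + (j - i)) = p m" if "i \<le> m" for m
  proof (cases "m = i")
    case False
    then have "Suc (i + (m - Suc i)) = m" "Suc (j + (m - Suc i)) = m + (j - i)"
      using that ij by linarith+
    then have "p m = p i * p (m - Suc i)" "p (m + (j - i)) = p j * p (m - Suc i)"
      by (simp_all only: p_mult)
    then show ?thesis using ij by simp
  qed (use ij in simp)
  have steps: "p (m + k * (j - i)) = p m" if "i \<le> m" for m k
  proof (induction k)
    case (Suc k)
    then show ?case using step[of "m + k * (j - i)"] that by (simp add: add.assoc add.commute[of "k * (j - i)"])
  qed simp
  \<comment> \<open>\<open>p n\<close> has \<open>n + 1\<close> factors, so the power with exponent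
    \<open>q\<close> is \<open>p (q - 1)\<close>, and squaring it moves the index by exactly
    \<open>q\<close>, a multiple of the period \<open>j - i\<close>.\<close>
  define q where "q = Suc i * (j - i)"
  have q: "Suc i \<le> q" using ij(1) mult_le_mono2[of 1 "j - i" "Suc i"] unfolding q_def by simp
  have "p (q - 1) * p (q - 1) = p (q - 1 + Suc i * (j - i))"
    using q unfolding p_mult q_def[symmetric] by (intro arg_cong[where f = p]) simp
  also have "\<dots> = p (q - 1)" using q by (intro steps) simp
  finally show ?thesis using that[of "q - 1"] by (simp add: Idem_def p_def)
qed

text \<open>An idempotent equals all its positive powers, so both idempotents equal the power of
  \<open>s\<close> with exponent \<open>(m + 1) * (n + 1)\<close>.\<close>

lemma idempotent_power_unique:
  fixes s :: "'a::semigroup_mult"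
  assumes "((*) s ^^ m) s \<in> Idem" "((*) s ^^ n) s \<in> Idem"
  shows "((*) s ^^ m) s = ((*) s ^^ n) s"
proof -
  have pow: "((*) s ^^ (k * Suc n + n)) s = ((*) s ^^ n) s" if "((*) s ^^ n) s \<in> Idem" for k n
  proof (induction k)
    case (Suc k)
    have "((*) s ^^ (Suc k * Suc n + n)) s = ((*) s ^^ n) s * ((*) s ^^ (k * Suc n + n)) s"
      unfolding funpow_mult_mult by (simp add: algebra_simps)
    then show ?case using Suc that by (simp add: Idem_def)
  qed simp
  have "n * Suc m + m = m * Suc n + n" by simp
  then show ?thesis using pow[OF assms(1), of n] pow[OF assms(2), of m] by metis
qed

lemma omega_power:
  fixes s :: "'a::{semigroup_mult,finite}"
  obtains n where "omega s = ((*) s ^^ n) s" "omega s \<in> Idem"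
proof -
  obtain n where n: "((*) s ^^ n) s \<in> Idem" using finite_semigroup_idempotent_power .
  have "omega s = ((*) s ^^ n) s"
    unfolding omega_def
  proof (rule the_equality)
    show "((*) s ^^ n) s * ((*) s ^^ n) s = ((*) s ^^ n) s \<and> (\<exists>m. ((*) s ^^ n) s = ((*) s ^^ m) s)"
      using n unfolding Idem_def by blast
    fix e assume "e * e = e \<and> (\<exists>m. e = ((*) s ^^ m) s)"
    then show "e = ((*) s ^^ n) s"
      using idempotent_power_unique[OF _ n] unfolding Idem_def by blast
  qed
  then show ?thesis using that n by simp
qed

lemma omega_in_Idem [simp]: "omega (s :: 'a::{semigroup_mult,finite}) \<in> Idem"
  using omega_power by blast

lemma Idem_mult_self: "x \<in> Idem \<Longrightarrow> x * x = x"
  by (simp add: Idem_def)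

lemma mult_omega_self:
  fixes s :: "'a::left_regular_band_of_groups"
  shows "s * omega s = s"
proof -
  obtain n where n: "omega s = ((*) s ^^ n) s" using omega_power by blast
  have "s * ((*) s ^^ n) s = ((*) s ^^ n) s * s"
    using funpow_mult_mult[of 0 s n] funpow_mult_mult[of n s 0] by simp
  then show ?thesis using n omega_mult_self[of s] by simp
qed

lemma mult_power_left:
  fixes s e :: "'a::semigroup_mult"
  assumes "e * s = s"
  shows "e * ((*) s ^^ n) s = ((*) s ^^ n) s"
  using assms by (cases n) (simp_all add: mult.assoc[symmetric])

lemma mult_omega_left:
  fixes s e :: "'a::{semigroup_mult,finite}"
  assumes "e * s = s"
  shows "e * omega s = omega s"
proof -
  obtain n where "omega s = ((*) s ^^ n) s" using omega_power by blast
  then show ?thesis using mult_power_left[OF assms] by simp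
qed

lemma mult_omega_right:
  fixes s e :: "'a::{semigroup_mult,finite}"
  assumes "s * e = s"
  shows "omega s * e = omega s"
proof -
  obtain n where n: "omega s = ((*) s ^^ n) s" using omega_power by blast
  have "((*) s ^^ n) s * e = ((*) s ^^ n) s"
    using assms by (induction n) (simp_all add: mult.assoc)
  then show ?thesis using n by simp
qed

text \<open>\<open>omega s\<close> is a power of \<open>s\<close> and so inherits the left unit
  \<open>e\<close>, while \<open>e = s' * s\<close> is unchanged by \<open>omega s\<close> on its
  right. This identifies \<open>omega s\<close> without computing powers.\<close>

lemma omega_eqI:
  fixes s e :: "'a::left_regular_band_of_groups"
  assumes "e * s = s" "s' * s = e"
  shows "omega s = e"
proof -
  have "e * omega s = e" using assms mult_omega_self[of s] by (metis mult.assoc)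
  then show ?thesis using mult_omega_left[OF assms(1)] by simp
qed

lemma omega_inverse:
  fixes s :: "'a::left_regular_band_of_groups"
  obtains s' where "s' * s = omega s" "s * s' = omega s" "omega s' = omega s"
proof -
  obtain n where n: "omega s = ((*) s ^^ n) s" "omega s \<in> Idem" using omega_power by blast
  \<comment> \<open>If \<open>omega s\<close> has exponent \<open>n + 1\<close>, then
    \<open>s'\<close> has exponent \<open>2 * n + 1\<close>, and one more factor \<open>s\<close>
    gives the square of \<open>omega s\<close>.\<close>
  define s' where "s' = ((*) s ^^ (n + n)) s"
  have e: "((*) s ^^ Suc (n + n)) s = omega s"
    using funpow_mult_mult[of n s n] n by (simp add: Idem_def)
  have 1: "s * s' = omega s" using e unfolding s'_def by simp
  have 2: "s' * s = omega s" using e funpow_mult_mult[of "n + n" s 0] unfolding s'_def by simp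
  have "omega s * s' = s'"
    unfolding s'_def by (intro mult_power_left omega_mult_self)
  then have "omega s' = omega s" using 1 by (rule omega_eqI)
  then show ?thesis using that 1 2 by blast
qed

text \<open>The idempotents \<open>omega (s * t)\<close> and \<open>omega s * omega t\<close> may
  differ, but each absorbs the other on its right, so they have the same support. Multiplicativity
  of levels rests on this.\<close>

lemma omega_mult_sim:
  fixes s t :: "'a::left_regular_band_of_groups"
  shows "omega (s * t) * (omega s * omega t) = omega (s * t)"
    and "omega s * omega t * omega (s * t) = omega s * omega t"
proof -
  have "omega (s * t) * omega s = omega (s * t)"
    using mult_omega_right[of "s * t" "omega s"] mult_mult_omega by blast
  moreover have "omega (s * t) * omega t = omega (s * t)"
    using mult_omega_right[of "s * t" "omega t"] by (simp add: mult.assoc mult_omega_self)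
  ultimately show "omega (s * t) * (omega s * omega t) = omega (s * t)"
    by (simp add: mult.assoc[symmetric])
  obtain s' where s': "s' * s = omega s" using omega_inverse by blast
  obtain t' where t': "t * t' = omega t" using omega_inverse by blast
  \<comment> \<open>Group inverses bring the product into a form that contains \<open>s * t\<close>
    followed by \<open>t'\<close>, to which the axiom \<open>mult_mult_omega\<close>
    applies.\<close>
  have ef: "omega s * omega t = s' * (s * t * t')" using s' t' by (simp add: mult.assoc[symmetric]) (simp add: mult.assoc)
  have "s * t * t' * omega (s * t) = s * t * t'" by (rule mult_mult_omega)
  then show "omega s * omega t * omega (s * t) = omega s * omega t"
    unfolding ef by (simp add: mult.assoc)
qed

section \<open>Levels and the order on supports\<close>

definition level :: "'a::semigroup_mult \<Rightarrow> 'a set"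
  where "level s = supp (omega s)"

lemma level_Idem: "x \<in> Idem \<Longrightarrow> level x = supp x"
  by (simp add: level_def omega_Idem)

lemma supp_in_Idem_supp: "x \<in> Idem \<Longrightarrow> supp x \<in> Idem_supp"
  by (simp add: Idem_supp_def)

lemma level_in_Idem_supp [simp]: "level (s :: 'a::{semigroup_mult,finite}) \<in> Idem_supp"
  by (simp add: level_def supp_in_Idem_supp)

lemma level_mult:
  fixes s t :: "'a::left_regular_band_of_groups"
  shows "level (s * t) = supp (omega s * omega t)"
  unfolding level_def by (simp add: supp_Idem_eq_iff Idem_mult omega_mult_sim)

lemma Idem_suppE:
  assumes "X \<in> Idem_supp"
  obtains x where "x \<in> Idem" "X = supp x"
  using assms by (auto simp: Idem_supp_def)

lemma supp_le_refl: "(X :: 'a::left_regular_band_of_groups set) \<in> Idem_supp \<Longrightarrow> supp_le X X"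
  by (auto elim!: Idem_suppE simp: supp_le_Idem_iff Idem_mult_self)

lemma supp_le_antisym:
  fixes X Y :: "'a::left_regular_band_of_groups set"
  assumes "X \<in> Idem_supp" "Y \<in> Idem_supp" "supp_le X Y" "supp_le Y X"
  shows "X = Y"
proof -
  obtain x where x: "x \<in> Idem" "X = supp x" using assms(1) by (rule Idem_suppE)
  obtain y where y: "y \<in> Idem" "Y = supp y" using assms(2) by (rule Idem_suppE)
  show ?thesis
    using assms(3,4) x y by (simp add: supp_le_Idem_iff[OF x(1) y(1)] supp_le_Idem_iff[OF y(1) x(1)]
        supp_Idem_eq_iff[OF x(1) y(1)])
qed

lemma supp_le_trans:
  fixes X Y Z :: "'a::left_regular_band_of_groups set"
  assumes "X \<in> Idem_supp" "Y \<in> Idem_supp" "Z \<in> Idem_supp" "supp_le X Y" "supp_le Y Z"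
  shows "supp_le X Z"
  using supp_less_trans[OF assms(1-3)] assms(4,5) supp_le_refl
  by (cases "X = Y"; cases "Y = Z") (auto simp: supp_less_def)

lemma supp_le_mult1:
  fixes x y :: "'a::left_regular_band_of_groups"
  assumes "x \<in> Idem" "y \<in> Idem"
  shows "supp_le (supp x) (supp (x * y))"
  using assms by (simp add: supp_le_Idem_iff Idem_mult Idem_lrb)

lemma supp_le_mult2:
  fixes x y :: "'a::left_regular_band_of_groups"
  assumes "x \<in> Idem" "y \<in> Idem"
  shows "supp_le (supp y) (supp (x * y))"
  using assms by (simp add: supp_le_Idem_iff Idem_mult Idem_mult_self mult.assoc)

lemma level_mult_ge1: "supp_le (level s) (level (s * t :: 'a::left_regular_band_of_groups))"
  by (simp add: level_mult) (simp add: level_def supp_le_mult1)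

lemma level_mult_ge2: "supp_le (level t) (level (s * t :: 'a::left_regular_band_of_groups))"
  by (simp add: level_mult) (simp add: level_def supp_le_mult2)

lemma mult_supp_eq:
  fixes x y :: "'a::left_regular_band_of_groups"
  assumes "x \<in> Idem" "y \<in> Idem" "supp x = supp y"
  shows "x * y = x"
  using assms by (simp add: supp_Idem_eq_iff)

section \<open>The maximal subgroups and the translations between them\<close>

lemma max_subgroup_iff: "s \<in> max_subgroup x \<longleftrightarrow> omega s = x"
  by (simp add: max_subgroup_def)

lemma Idem_in_max_subgroup: "x \<in> Idem \<Longrightarrow> x \<in> max_subgroup x"
  by (simp add: max_subgroup_iff omega_Idem)

lemma max_subgroup_left_unit:
  fixes s :: "'a::left_regular_band_of_groups"
  shows "s \<in> max_subgroup x \<Longrightarrow> x * s = s"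
  using omega_mult_self by (auto simp: max_subgroup_iff)

lemma max_subgroup_right_unit:
  fixes s :: "'a::left_regular_band_of_groups"
  shows "s \<in> max_subgroup x \<Longrightarrow> s * x = s"
  using mult_omega_self by (auto simp: max_subgroup_iff)

text \<open>The hypothesis on levels amounts to \<open>x * omega s = x\<close>. If \<open>s'\<close>
  is inverse to \<open>s\<close>, then \<open>x * s'\<close> is a left inverse of
  \<open>x * s\<close>, because \<open>x * s' * x = x * s'\<close>.\<close>

lemma mult_Idem_in_max_subgroup:
  fixes x s :: "'a::left_regular_band_of_groups"
  assumes "x \<in> Idem" "supp_le (level s) (supp x)"
  shows "x * s \<in> max_subgroup x"
proof -
  have xw: "x * omega s = x" using assms by (simp add: level_def supp_le_Idem_iff)
  obtain s' where s': "s' * s = omega s" using omega_inverse by blast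
  have "x * s' * (x * s) = x * s' * x * s" by (rule mult.assoc[symmetric])
  also have "x * s' * x = x * s'" by (rule Idem_lrb[OF assms(1)])
  also have "x * s' * s = x * (s' * s)" by (rule mult.assoc)
  finally have "x * s' * (x * s) = x" using s' xw by simp
  moreover have "x * (x * s) = x * s" using assms by (simp add: Idem_mult_self mult.assoc[symmetric])
  ultimately show ?thesis unfolding max_subgroup_iff by (intro omega_eqI)
qed

lemma max_subgroup_mult:
  fixes s t :: "'a::left_regular_band_of_groups"
  assumes "s \<in> max_subgroup x" "t \<in> max_subgroup x"
  shows "s * t \<in> max_subgroup x"
proof -
  obtain s' where s': "s' * s = x" using omega_inverse[of s] assms by (auto simp: max_subgroup_iff)
  obtain t' where t': "t' * t = x" using omega_inverse[of t] assms by (auto simp: max_subgroup_iff)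
  have "t' * s' * (s * t) = t' * (s' * s * t)" by (simp only: mult.assoc)
  also have "\<dots> = x" using assms by (simp add: s' t' max_subgroup_left_unit)
  finally have "t' * s' * (s * t) = x" .
  moreover have "x * (s * t) = s * t"
    using assms by (simp add: max_subgroup_left_unit mult.assoc[symmetric])
  ultimately show ?thesis unfolding max_subgroup_iff by (intro omega_eqI)
qed

lemma max_subgroup_inverse:
  fixes s :: "'a::left_regular_band_of_groups"
  assumes "s \<in> max_subgroup x"
  obtains s' where "s' \<in> max_subgroup x" "s' * s = x" "s * s' = x"
  using omega_inverse[of s] assms by (auto simp: max_subgroup_iff)

lemma max_subgroup_translate_bij:
  fixes s :: "'a::left_regular_band_of_groups"
  assumes "s \<in> max_subgroup x"
  shows "bij_betw ((*) s) (max_subgroup x) (max_subgroup x)"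
proof -
  obtain s' where s': "s' \<in> max_subgroup x" "s' * s = x" "s * s' = x"
    using max_subgroup_inverse[OF assms] .
  show ?thesis
    by (rule bij_betw_byWitness[where f' = "(*) s'"])
      (auto simp: mult.assoc[symmetric] s' max_subgroup_left_unit max_subgroup_mult assms)
qed

lemma max_subgroup_translate_bij_right:
  fixes s :: "'a::left_regular_band_of_groups"
  assumes "s \<in> max_subgroup x"
  shows "bij_betw (\<lambda>t. t * s) (max_subgroup x) (max_subgroup x)"
proof -
  obtain s' where s': "s' \<in> max_subgroup x" "s' * s = x" "s * s' = x"
    using max_subgroup_inverse[OF assms] .
  show ?thesis
    by (rule bij_betw_byWitness[where f' = "\<lambda>t. t * s'"])
      (auto simp: mult.assoc s' max_subgroup_right_unit max_subgroup_mult assms)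
qed

text \<open>Translation by \<open>x\<close> is the inverse map, since \<open>x * y = x\<close> and
  \<open>x\<close> is the unit of its group.\<close>

lemma max_subgroup_change_bij:
  fixes x y :: "'a::left_regular_band_of_groups"
  assumes "x \<in> Idem" "y \<in> Idem" "supp x = supp y"
  shows "bij_betw ((*) y) (max_subgroup x) (max_subgroup y)"
proof -
  have mem: "b * s \<in> max_subgroup b" if "a \<in> Idem" "b \<in> Idem" "supp a = supp b" "s \<in> max_subgroup a" for a b s :: 'a
    using that by (intro mult_Idem_in_max_subgroup)
      (auto simp: level_def max_subgroup_iff supp_in_Idem_supp intro: supp_le_refl)
  have *: "a * (b * s) = s" if "a \<in> Idem" "b \<in> Idem" "supp a = supp b" "s \<in> max_subgroup a" for a b s :: 'a
    using mult_supp_eq[OF that(1-3)] max_subgroup_left_unit[OF that(4)] by (metis mult.assoc)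
  show ?thesis
    using mem * assms by (intro bij_betw_byWitness[where f' = "(*) x"]) auto
qed

section \<open>Bilinearity and associativity of the algebra\<close>

lemma alg_mult_nth: "(f \<star> g) $ r = (\<Sum>s\<in>UNIV. \<Sum>t\<in>UNIV. if s * t = r then f $ s * g $ t else 0)"
  unfolding alg_mult_def H_def
  by (auto simp: sum_component axis_def intro!: sum.cong)

lemma star_add_left: "(f + g) \<star> h = f \<star> h + g \<star> h"
  unfolding alg_mult_def by (simp add: vec.scale_left_distrib distrib_left distrib_right sum.distrib)

lemma star_add_right: "f \<star> (g + h) = f \<star> g + f \<star> h"
  unfolding alg_mult_def by (simp add: vec.scale_left_distrib distrib_left distrib_right sum.distrib)

lemma star_scale_left: "(c *s f) \<star> g = c *s (f \<star> g)"
  unfolding alg_mult_def by (simp add: vec.scale_sum_right mult.assoc)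

lemma star_scale_right: "f \<star> (c *s g) = c *s (f \<star> g)"
  unfolding alg_mult_def by (simp add: vec.scale_sum_right mult_ac)

lemma star_zero_left [simp]: "0 \<star> g = 0"
  using star_scale_left[of 0 0 g] by simp

lemma star_zero_right [simp]: "f \<star> 0 = 0"
  using star_scale_right[of f 0 0] by simp

lemma star_diff_left: "(f - g) \<star> h = f \<star> h - g \<star> h"
  using star_add_left[of "f - g" g h] by simp

lemma star_diff_right: "f \<star> (g - h) = f \<star> g - f \<star> h"
  using star_add_right[of f "g - h" h] by simp

lemma star_sum_left: "(\<Sum>i\<in>I. f i) \<star> g = (\<Sum>i\<in>I. f i \<star> g)"
  by (induction I rule: infinite_finite_induct) (simp_all add: star_add_left)

lemma star_sum_right: "f \<star> (\<Sum>i\<in>I. g i) = (\<Sum>i\<in>I. f \<star> g i)"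
  by (induction I rule: infinite_finite_induct) (simp_all add: star_add_right)

lemma alg_expansion: "f = (\<Sum>s\<in>UNIV. f $ s *s H s)"
  unfolding H_def by (rule basis_expansion[symmetric])

lemma star_H_expansion_left: "f \<star> g = (\<Sum>s\<in>UNIV. f $ s *s (H s \<star> g))"
  by (simp only: star_sum_left[symmetric] star_scale_left[symmetric] alg_expansion[symmetric])

lemma star_H_expansion_right: "f \<star> g = (\<Sum>s\<in>UNIV. g $ s *s (f \<star> H s))"
  by (simp only: star_sum_right[symmetric] star_scale_right[symmetric] alg_expansion[symmetric])

lemma H_nth: "H s $ r = (if r = s then 1 else 0)"
  by (simp add: H_def axis_def)

lemma H_star_H: "H s \<star> H t = H (s * t)"
proof -
  have "(H s $ a * H t $ b) *s H (a * b) = (if a = s then if b = t then H (a * b) else 0 else 0)" for a b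
    by (simp add: H_nth)
  then have "H s \<star> H t = (\<Sum>a\<in>UNIV. \<Sum>b\<in>UNIV. if a = s then if b = t then H (a * b) else 0 else 0)"
    unfolding alg_mult_def by simp
  also have "\<dots> = (\<Sum>a\<in>UNIV. if a = s then \<Sum>b\<in>UNIV. if b = t then H (a * b) else 0 else 0)"
    by (intro sum.cong) auto
  finally show ?thesis by simp
qed

lemma star_assoc: "f \<star> g \<star> h = f \<star> (g \<star> h)"
proof -
  have 1: "H s \<star> H t \<star> h = H s \<star> (H t \<star> h)" for s t
    unfolding star_H_expansion_right[of "H t" h] star_H_expansion_right[of "H s \<star> H t" h]
    by (simp add: H_star_H mult.assoc star_sum_right star_scale_right)
  have 2: "H s \<star> g \<star> h = H s \<star> (g \<star> h)" for s
    unfolding star_H_expansion_left[of g h] star_H_expansion_right[of "H s" g]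
    by (simp add: 1 star_sum_left star_sum_right star_scale_left star_scale_right)
  show ?thesis
    unfolding star_H_expansion_left[of f g] star_H_expansion_left[of f "g \<star> h"]
    by (simp add: 2 star_sum_left star_scale_left)
qed

lemma star_nth_nonzeroE:
  assumes "(f \<star> g) $ r \<noteq> 0"
  obtains s t where "f $ s \<noteq> 0" "g $ t \<noteq> 0" "r = s * t"
proof -
  have "\<exists>s t. f $ s \<noteq> 0 \<and> g $ t \<noteq> 0 \<and> r = s * t"
  proof (rule ccontr)
    assume "\<not> ?thesis"
    then have "(f \<star> g) $ r = 0"
      unfolding alg_mult_nth by (intro sum.neutral ballI) auto
    then show False using assms by simp
  qed
  then show ?thesis using that by blast
qed

section \<open>The idempotents of a homogeneous section\<close>

lemma Idem_supp_induct [consumes 1, case_names less]: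
  fixes X :: "'a::left_regular_band_of_groups set"
  assumes "X \<in> Idem_supp"
    and "\<And>X. X \<in> Idem_supp \<Longrightarrow> (\<And>Y. Y \<in> Idem_supp \<Longrightarrow> supp_less X Y \<Longrightarrow> P Y) \<Longrightarrow> P X"
  shows "P X"
proof -
  have "X \<in> Idem_supp \<longrightarrow> P X" for X
  \<comment> \<open>The termination of \<open>e_circ\<close> already supplies induction from larger
    supports; its section argument is carried along unchanged, so any value serves.\<close>
  proof (induction "undefined :: 'a set \<Rightarrow> 'a alg" X rule: e_circ.induct)
    case (1 X)
    show ?case
    proof
      assume X: "X \<in> Idem_supp"
      show "P X"
      proof (rule assms(2)[OF X])
        fix Y assume "Y \<in> Idem_supp" "supp_less X Y"
        then show "P Y" using 1[OF X, of Y] by simp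
      qed
    qed
  qed
  then show ?thesis using assms(1) by blast
qed

section \<open>Elements killed from the left by all levels not below a given support\<close>

definition annihilated_above :: "'a set \<Rightarrow> ('a::{semigroup_mult,finite}) alg \<Rightarrow> bool"
  where "annihilated_above X w \<longleftrightarrow> (\<forall>t. \<not> supp_le (level t) X \<longrightarrow> H t \<star> w = 0)"

text \<open>Levels only grow under multiplication: if the level of \<open>t\<close> is not below
  \<open>X\<close>, neither is that of \<open>t * s\<close>. So the condition passes to the left
  ideal generated by \<open>w\<close>.\<close>

lemma annihilated_above_star:
  fixes w :: "('a::left_regular_band_of_groups) alg"
  assumes "X \<in> Idem_supp" "annihilated_above X w"
  shows "annihilated_above X (a \<star> w)"
  unfolding annihilated_above_def
proof (intro allI impI)
  fix t assume t: "\<not> supp_le (level t) X"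
  have "H t \<star> (H s \<star> w) = 0" for s
  proof -
    have "\<not> supp_le (level (t * s)) X"
      using t supp_le_trans[OF _ _ assms(1) level_mult_ge1[of t s]] by auto
    then show ?thesis
      using assms(2) by (simp add: annihilated_above_def star_assoc[symmetric] H_star_H)
  qed
  then show "H t \<star> (a \<star> w) = 0"
    by (simp add: star_H_expansion_left[of a w] star_sum_right star_scale_right)
qed

lemma annihilated_above_star_zero:
  assumes "annihilated_above X w" "\<And>s. a $ s \<noteq> 0 \<Longrightarrow> \<not> supp_le (level s) X"
  shows "a \<star> w = 0"
  unfolding star_H_expansion_left[of a w]
  using assms by (intro sum.neutral) (auto simp: annihilated_above_def)

context
  fixes u :: "'a::left_regular_band_of_groups set \<Rightarrow> 'a alg"
  assumes hs: "homogeneous_section u"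
begin

lemma homogeneous_section_nth:
  assumes "X \<in> Idem_supp" "u X $ s \<noteq> 0"
  shows "s \<in> Idem \<and> supp s = X"
proof (rule ccontr)
  assume s: "\<not> ?thesis"
  obtain c :: "'a \<Rightarrow> complex" where c: "u X = (\<Sum>x | x \<in> Idem \<and> supp x = X. c x *s H x)"
    using hs assms(1) unfolding homogeneous_section_def by blast
  have "u X $ s = 0"
    unfolding c sum_component using s by (intro sum.neutral) (auto simp: H_nth split: if_splits)
  then show False using assms(2) by simp
qed

text \<open>The coefficients of \<open>u X\<close> sum to \<open>1\<close>, so \<open>u X\<close>
  acts on \<open>g\<close> like its basis elements when these all act alike.\<close>

lemma homogeneous_section_star:
  assumes "X \<in> Idem_supp" "\<And>x. x \<in> Idem \<Longrightarrow> supp x = X \<Longrightarrow> H x \<star> g = h"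
  shows "u X \<star> g = h"
proof -
  obtain c :: "'a \<Rightarrow> complex" where c: "(\<Sum>x | x \<in> Idem \<and> supp x = X. c x) = 1"
      "u X = (\<Sum>x | x \<in> Idem \<and> supp x = X. c x *s H x)"
    using hs assms(1) unfolding homogeneous_section_def by blast
  have "u X \<star> g = (\<Sum>x | x \<in> Idem \<and> supp x = X. c x *s h)"
    unfolding c(2) star_sum_left star_scale_left using assms(2) by (intro sum.cong) auto
  then show ?thesis by (simp add: vec.scale_sum_left[symmetric] c(1))
qed

lemma star_homogeneous_section:
  assumes "X \<in> Idem_supp" "\<And>x. x \<in> Idem \<Longrightarrow> supp x = X \<Longrightarrow> f \<star> H x = h"
  shows "f \<star> u X = h"
proof -
  obtain c :: "'a \<Rightarrow> complex" where c: "(\<Sum>x | x \<in> Idem \<and> supp x = X. c x) = 1"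
      "u X = (\<Sum>x | x \<in> Idem \<and> supp x = X. c x *s H x)"
    using hs assms(1) unfolding homogeneous_section_def by blast
  have "f \<star> u X = (\<Sum>x | x \<in> Idem \<and> supp x = X. c x *s h)"
    unfolding c(2) star_sum_right star_scale_right using assms(2) by (intro sum.cong) auto
  then show ?thesis by (simp add: vec.scale_sum_left[symmetric] c(1))
qed

lemma H_star_homogeneous_section:
  assumes "s * omega s = s" "supp_le X (level s)" "X \<in> Idem_supp"
  shows "H s \<star> u X = H s"
proof (rule star_homogeneous_section[OF assms(3)])
  fix x assume x: "x \<in> Idem" "supp x = X"
  then have "omega s * x = omega s" using assms(2) by (auto simp: level_def supp_le_Idem_iff)
  then have "s * x = s" using assms(1) by (metis mult.assoc)
  then show "H s \<star> H x = H s" by (simp add: H_star_H)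
qed

lemma homogeneous_section_idem:
  assumes "X \<in> Idem_supp"
  shows "u X \<star> u X = u X"
proof -
  have "u X \<star> u X = (\<Sum>s\<in>UNIV. u X $ s *s (H s \<star> u X))" by (rule star_H_expansion_left)
  also have "\<dots> = (\<Sum>s\<in>UNIV. u X $ s *s H s)"
  proof (intro sum.cong refl)
    fix s show "u X $ s *s (H s \<star> u X) = u X $ s *s H s"
      using homogeneous_section_nth[OF assms, of s] H_star_homogeneous_section[of s X] assms
      by (cases "u X $ s = 0") (auto simp: mult_omega_self level_Idem intro: supp_le_refl)
  qed
  finally show ?thesis by (simp add: alg_expansion[symmetric])
qed

text \<open>Idempotency lets \<open>u X\<close> be pulled out on the left. If
  \<open>a \<star> u X = a\<close>, then \<open>a \<star> e_circ u X\<close> is \<open>a\<close>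
  minus the sum of the \<open>a \<star> e_circ u Y\<close> with \<open>Y\<close> strictly above
  \<open>X\<close>.\<close>

lemma e_circ_factor:
  assumes "X \<in> Idem_supp"
  shows "e_circ u X = u X \<star> (u X - (\<Sum>Y | Y \<in> Idem_supp \<and> supp_less X Y. e_circ u Y))"
  using assms by (subst e_circ_rec) (simp_all add: star_diff_right star_sum_right homogeneous_section_idem)

lemma homogeneous_section_star_e_circ:
  assumes "X \<in> Idem_supp"
  shows "u X \<star> e_circ u X = e_circ u X"
  using assms by (subst (1 2) e_circ_factor) (simp_all add: star_assoc[symmetric] homogeneous_section_idem)

lemma e_circ_nth:
  assumes "X \<in> Idem_supp" "e_circ u X $ s \<noteq> 0"
  shows "s \<in> Idem \<and> supp_le X (supp s)"
  using assms
proof (induction X arbitrary: s rule: Idem_supp_induct)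
  case (less X)
  have "u X $ s \<noteq> 0 \<or> (\<exists>Y\<in>{Y. Y \<in> Idem_supp \<and> supp_less X Y}. (u X \<star> e_circ u Y) $ s \<noteq> 0)"
    using less.prems unfolding e_circ_rec[OF less.hyps] vector_minus_component sum_component
    by (metis (no_types, lifting) diff_zero sum.not_neutral_contains_not_neutral)
  then show ?case
  proof (elim disjE bexE)
    assume "u X $ s \<noteq> 0"
    then show ?thesis using homogeneous_section_nth[OF less.hyps] less.hyps by (auto intro: supp_le_refl)
  next
    fix Y assume Y: "Y \<in> {Y. Y \<in> Idem_supp \<and> supp_less X Y}" "(u X \<star> e_circ u Y) $ s \<noteq> 0"
    then obtain y t where yt: "u X $ y \<noteq> 0" "e_circ u Y $ t \<noteq> 0" "s = y * t"
      by (auto elim: star_nth_nonzeroE)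
    have "t \<in> Idem" using less.IH[of Y t] Y yt by auto
    moreover have "y \<in> Idem" "supp y = X" using homogeneous_section_nth[OF less.hyps yt(1)] by auto
    ultimately show ?thesis using yt(3) supp_le_mult1[of y t] by (auto intro: Idem_mult)
  qed
qed

text \<open>As \<open>H x\<close> absorbs \<open>u (supp x)\<close>, the term for
  \<open>Y = supp x\<close> is \<open>H x\<close> minus all the remaining terms.\<close>

lemma sum_above_H_star_e_circ:
  assumes "x \<in> Idem"
  shows "(\<Sum>Y | Y \<in> Idem_supp \<and> supp_le (supp x) Y. H x \<star> e_circ u Y) = H x"
proof -
  have X: "supp x \<in> Idem_supp" using assms by (rule supp_in_Idem_supp)
  have Hu: "H x \<star> u (supp x) = H x"
    using assms X by (intro H_star_homogeneous_section) (auto simp: mult_omega_self level_Idem intro: supp_le_refl)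
  have "{Y. Y \<in> Idem_supp \<and> supp_le (supp x) Y} = insert (supp x) {Y. Y \<in> Idem_supp \<and> supp_less (supp x) Y}"
    using X supp_le_refl[OF X] by (auto simp: supp_less_def)
  moreover have "\<not> supp_less (supp x) (supp x)" by (simp add: supp_less_def)
  ultimately have "(\<Sum>Y | Y \<in> Idem_supp \<and> supp_le (supp x) Y. H x \<star> e_circ u Y) =
      H x \<star> e_circ u (supp x) + (\<Sum>Y | Y \<in> Idem_supp \<and> supp_less (supp x) Y. H x \<star> e_circ u Y)"
    by simp
  also have "H x \<star> e_circ u (supp x) = H x - (\<Sum>Y | Y \<in> Idem_supp \<and> supp_less (supp x) Y. H x \<star> e_circ u Y)"
    unfolding e_circ_factor[OF X] star_assoc[symmetric] Hu by (simp add: star_diff_right star_sum_right Hu)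
  finally show ?thesis by simp
qed

text \<open>Induction from larger supports. Through the factor \<open>u X\<close>,
  \<open>H x\<close> turns into a combination of \<open>H z\<close> with \<open>z = x * y\<close>
  and \<open>supp y = X\<close>. Such an \<open>H z\<close> gives \<open>H z\<close> both on
  \<open>u X\<close> and on the sum of the larger \<open>e_circ u Y\<close>, so the difference
  vanishes.\<close>

lemma Idem_star_e_circ_zero:
  assumes "X \<in> Idem_supp" "x \<in> Idem" "\<not> supp_le (supp x) X"
  shows "H x \<star> e_circ u X = 0"
  using assms
proof (induction X arbitrary: x rule: Idem_supp_induct)
  case (less X)
  let ?d = "u X - (\<Sum>Y | Y \<in> Idem_supp \<and> supp_less X Y. e_circ u Y)"
  have "H x \<star> u X \<star> ?d = (\<Sum>y\<in>UNIV. u X $ y *s (H (x * y) \<star> ?d))"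
    by (subst star_H_expansion_right) (simp add: star_sum_left star_scale_left H_star_H)
  also have "\<dots> = 0"
  proof (intro sum.neutral ballI)
    fix y
    show "u X $ y *s (H (x * y) \<star> ?d) = 0"
    proof (cases "u X $ y = 0")
      case False
      then have y: "y \<in> Idem" "supp y = X" using homogeneous_section_nth[OF less.hyps] by auto
      define z where "z = x * y"
      have z: "z \<in> Idem" using y less.prems by (simp add: z_def Idem_mult)
      have xz: "supp_le (supp x) (supp z)" and Xz: "supp_le X (supp z)"
        using supp_le_mult1[of x y] supp_le_mult2[of x y] y less.prems by (auto simp: z_def)
      note S = supp_in_Idem_supp[OF z] supp_in_Idem_supp[OF less.prems(1)] less.hyps
      \<comment> \<open>\<open>supp z\<close> is above both \<open>X\<close> and
        \<open>supp x\<close>, and \<open>X\<close> is not above \<open>supp x\<close>, so every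
        support above \<open>supp z\<close> is strictly above \<open>X\<close>. The other
        \<open>Y\<close> strictly above \<open>X\<close> contribute nothing by the induction
        hypothesis.\<close>
      have "{Y. Y \<in> Idem_supp \<and> supp_le (supp z) Y} \<subseteq> {Y. Y \<in> Idem_supp \<and> supp_less X Y}"
        using supp_le_trans[OF S(3,1) _ Xz] supp_le_trans[OF S(2,1) _ xz] less.prems
        by (auto simp: supp_less_def)
      then have "(\<Sum>Y | Y \<in> Idem_supp \<and> supp_less X Y. H z \<star> e_circ u Y)
          = (\<Sum>Y | Y \<in> Idem_supp \<and> supp_le (supp z) Y. H z \<star> e_circ u Y)"
        using less.IH z by (intro sum.mono_neutral_right) auto
      then have "H z \<star> ?d = 0"
        using H_star_homogeneous_section[of z X] z Xz S sum_above_H_star_e_circ[OF z]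
        by (simp add: star_diff_right star_sum_right mult_omega_self level_Idem)
      then show ?thesis by (simp add: z_def)
    qed simp
  qed
  finally show ?case by (simp add: e_circ_factor[OF less.hyps] star_assoc)
qed

lemma H_star_e_circ: "H s \<star> H (omega s) \<star> e_circ u X = H s \<star> e_circ u X"
  by (simp add: H_star_H mult_omega_self)

lemma e_circ_annihilated_above:
  assumes "X \<in> Idem_supp"
  shows "annihilated_above X (e_circ u X)"
  unfolding annihilated_above_def
proof (intro allI impI)
  fix t assume "\<not> supp_le (level t) X"
  then have "H (omega t) \<star> e_circ u X = 0"
    using Idem_star_e_circ_zero[OF assms, of "omega t"] by (simp add: level_def)
  then show "H t \<star> e_circ u X = 0"
    using H_star_e_circ[of t X] by (simp add: star_assoc)
qed

text \<open>For an idempotent, only the supports above its own contribute, and these terms add up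
  correctly. A general \<open>H s\<close> is first written as
  \<open>H s \<star> H (omega s)\<close>.\<close>

lemma star_sum_e_circ: "a \<star> (\<Sum>X\<in>Idem_supp. e_circ u X) = a"
proof -
  have "H s \<star> (\<Sum>X\<in>Idem_supp. e_circ u X) = H s" for s
  proof -
    have "(\<Sum>X\<in>Idem_supp. H (omega s) \<star> e_circ u X) =
        (\<Sum>X | X \<in> Idem_supp \<and> supp_le (supp (omega s)) X. H (omega s) \<star> e_circ u X)"
      by (intro sum.mono_neutral_right) (auto intro: Idem_star_e_circ_zero)
    then have "H (omega s) \<star> (\<Sum>X\<in>Idem_supp. e_circ u X) = H (omega s)"
      by (simp add: star_sum_right sum_above_H_star_e_circ)
    then show ?thesis by (metis H_star_H mult_omega_self star_assoc)
  qed
  then show ?thesis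
    by (subst star_H_expansion_left) (simp add: alg_expansion[symmetric])
qed

text \<open>\<open>e_circ u X\<close> has coefficients only at idempotents with support above
  \<open>X\<close>. No such support is below \<open>Y\<close>, since otherwise \<open>X\<close>
  would be.\<close>

lemma e_circ_star_not_le:
  assumes "Y \<in> Idem_supp" "annihilated_above Y w" "X \<in> Idem_supp" "\<not> supp_le X Y"
  shows "e_circ u X \<star> w = 0"
proof (rule annihilated_above_star_zero[OF assms(2)])
  fix s assume "e_circ u X $ s \<noteq> 0"
  then have s: "s \<in> Idem" "supp_le X (supp s)" using e_circ_nth[OF assms(3)] by auto
  then show "\<not> supp_le (level s) Y"
    using supp_le_trans[OF assms(3) _ assms(1) s(2)] assms(4) by (auto simp: level_Idem supp_in_Idem_supp)
qed

text \<open>The corrections in the recursion involve only supports strictly above \<open>X\<close>,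
  and these kill \<open>w\<close>.\<close>

lemma e_circ_star_same:
  assumes "X \<in> Idem_supp" "annihilated_above X w"
  shows "e_circ u X \<star> w = u X \<star> w"
proof -
  have "e_circ u Y \<star> w = 0" if "Y \<in> Idem_supp" "supp_less X Y" for Y
    using that assms supp_le_antisym[OF assms(1) that(1)]
    by (intro e_circ_star_not_le[OF assms(1,2)]) (auto simp: supp_less_def)
  then show ?thesis
    by (subst e_circ_rec[OF assms(1)]) (simp add: star_diff_left star_sum_left star_assoc)
qed

text \<open>If \<open>X\<close> is below \<open>Y\<close>, induction from larger supports leaves
  only the correction for \<open>Z = Y\<close>. It contributes \<open>u X \<star> w\<close> and
  cancels the leading term.\<close>

lemma e_circ_star_different:
  assumes "X \<in> Idem_supp" "Y \<in> Idem_supp" "annihilated_above Y w" "u Y \<star> w = w" "X \<noteq> Y"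
  shows "e_circ u X \<star> w = 0"
  using assms(1,5)
proof (induction X rule: Idem_supp_induct)
  case (less X)
  show ?case
  proof (cases "supp_le X Y")
    case False
    then show ?thesis using e_circ_star_not_le assms less.hyps by blast
  next
    case True
    then have Y: "Y \<in> {Z. Z \<in> Idem_supp \<and> supp_less X Z}"
      using assms less.prems by (auto simp: supp_less_def)
    have "(\<Sum>Z | Z \<in> Idem_supp \<and> supp_less X Z. e_circ u Z \<star> w)
        = (\<Sum>Z | Z \<in> Idem_supp \<and> supp_less X Z. if Z = Y then w else 0)"
      using less.IH e_circ_star_same[OF assms(2,3)] assms(4) by (intro sum.cong) auto
    also have "\<dots> = w" using Y by simp
    finally have *: "(\<Sum>Z | Z \<in> Idem_supp \<and> supp_less X Z. e_circ u Z \<star> w) = w" .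
    have "e_circ u X \<star> w = u X \<star> w - (\<Sum>Z | Z \<in> Idem_supp \<and> supp_less X Z. u X \<star> (e_circ u Z \<star> w))"
      by (subst e_circ_rec[OF less.hyps]) (simp add: star_diff_left star_sum_left star_assoc)
    also have "\<dots> = u X \<star> w - u X \<star> w" by (simp only: star_sum_right[symmetric] *)
    finally show ?thesis by simp
  qed
qed
end

section \<open>Characters and their idempotents\<close>

lemma character_mult:
  "\<lbrakk>\<phi> \<in> characters x; s \<in> max_subgroup x; t \<in> max_subgroup x\<rbrakk> \<Longrightarrow> \<phi> (s * t) = \<phi> s * \<phi> t"
  by (simp add: characters_def)

lemma character_nonzero: "\<lbrakk>\<phi> \<in> characters x; s \<in> max_subgroup x\<rbrakk> \<Longrightarrow> \<phi> s \<noteq> 0"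
  by (auto simp: characters_def)

lemma character_unit:
  assumes "x \<in> Idem" "\<phi> \<in> characters x"
  shows "\<phi> x = 1"
proof -
  have x: "x \<in> max_subgroup x" using assms(1) by (rule Idem_in_max_subgroup)
  have "\<phi> x * \<phi> x = \<phi> x" using character_mult[OF assms(2) x x] assms(1) by (simp add: Idem_mult_self)
  then show ?thesis using character_nonzero[OF assms(2) x] by simp
qed

lemma card_max_subgroup_pos: "x \<in> Idem \<Longrightarrow> 0 < card (max_subgroup (x :: 'a::{semigroup_mult,finite}))"
  using Idem_in_max_subgroup[of x] by (auto simp: card_gt_0_iff)

text \<open>Translation by \<open>s\<close> permutes the group, so the product of all values of
  \<open>\<phi>\<close> is unchanged when every factor is multiplied by
  \<open>\<phi> s\<close>.\<close>

lemma character_power_card: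
  fixes x :: "'a::left_regular_band_of_groups"
  assumes "\<phi> \<in> characters x" "s \<in> max_subgroup x"
  shows "\<phi> s ^ card (max_subgroup x) = 1"
proof -
  have "(\<Prod>t\<in>max_subgroup x. \<phi> t) = (\<Prod>t\<in>max_subgroup x. \<phi> (s * t))"
    using prod.reindex_bij_betw[OF max_subgroup_translate_bij[OF assms(2)], of \<phi>] by simp
  also have "\<dots> = (\<Prod>t\<in>max_subgroup x. \<phi> s * \<phi> t)"
    using assms by (intro prod.cong) (auto simp: character_mult)
  also have "\<dots> = \<phi> s ^ card (max_subgroup x) * (\<Prod>t\<in>max_subgroup x. \<phi> t)"
    by (simp add: prod.distrib)
  finally show ?thesis using character_nonzero[OF assms(1)] by simp
qed

lemma character_cnj_mult:
  fixes x :: "'a::left_regular_band_of_groups"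
  assumes "x \<in> Idem" "\<phi> \<in> characters x" "s \<in> max_subgroup x"
  shows "\<phi> s * cnj (\<phi> s) = 1"
proof -
  have "norm (\<phi> s) = 1"
    using power_eq_1_iff[OF character_power_card[OF assms(2,3)]] card_max_subgroup_pos[OF assms(1)]
    by linarith
  then show ?thesis by (simp add: complex_norm_square[symmetric])
qed

lemma finite_characters:
  fixes x :: "'a::left_regular_band_of_groups"
  assumes "x \<in> Idem"
  shows "finite (characters x)"
proof (rule finite_subset)
  show "characters x \<subseteq> max_subgroup x \<rightarrow>\<^sub>E {z. z ^ card (max_subgroup x) = 1}"
  proof
    fix \<phi> assume \<phi>: "\<phi> \<in> characters x"
    then have "\<phi> \<in> extensional (max_subgroup x)" by (simp add: characters_def PiE_iff)
    then show "\<phi> \<in> max_subgroup x \<rightarrow>\<^sub>E {z. z ^ card (max_subgroup x) = 1}"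
      using character_power_card[OF \<phi>] by (simp add: PiE_iff)
  qed
  show "finite (max_subgroup x \<rightarrow>\<^sub>E {z::complex. z ^ card (max_subgroup x) = 1})"
    using card_max_subgroup_pos[OF assms] by (intro finite_PiE finite_roots_unity) auto
qed

text \<open>Reindexing along translation by \<open>s\<close> pulls out the conjugate of
  \<open>\<phi> s\<close>, which is its inverse because character values have modulus one.\<close>

lemma H_star_E_char:
  fixes x :: "'a::left_regular_band_of_groups"
  assumes "x \<in> Idem" "\<phi> \<in> characters x" "s \<in> max_subgroup x"
  shows "H s \<star> E_char (x, \<phi>) = \<phi> s *s E_char (x, \<phi>)"
proof -
  have "(\<Sum>t\<in>max_subgroup x. cnj (\<phi> t) *s H t)
      = (\<Sum>t\<in>max_subgroup x. cnj (\<phi> (s * t)) *s H (s * t))"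
    using sum.reindex_bij_betw[OF max_subgroup_translate_bij[OF assms(3)], of "\<lambda>t. cnj (\<phi> t) *s H t"]
    by simp
  also have "\<dots> = (\<Sum>t\<in>max_subgroup x. cnj (\<phi> s) *s (cnj (\<phi> t) *s H (s * t)))"
    using assms by (intro sum.cong) (auto simp: character_mult)
  finally have *: "\<phi> s *s (\<Sum>t\<in>max_subgroup x. cnj (\<phi> t) *s H t)
      = (\<Sum>t\<in>max_subgroup x. cnj (\<phi> t) *s H (s * t))"
    using character_cnj_mult[OF assms] by (simp add: vec.scale_sum_right mult.assoc[symmetric])
  show ?thesis
    unfolding E_char_def prod.case star_scale_right star_sum_right H_star_H *[symmetric]
    by (rule vec.scale_left_commute)
qed

lemma E_char_star_H:
  fixes x :: "'a::left_regular_band_of_groups"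
  assumes "x \<in> Idem" "\<phi> \<in> characters x" "s \<in> max_subgroup x"
  shows "E_char (x, \<phi>) \<star> H s = \<phi> s *s E_char (x, \<phi>)"
proof -
  have "(\<Sum>t\<in>max_subgroup x. cnj (\<phi> t) *s H t)
      = (\<Sum>t\<in>max_subgroup x. cnj (\<phi> (t * s)) *s H (t * s))"
    using sum.reindex_bij_betw[OF max_subgroup_translate_bij_right[OF assms(3)], of "\<lambda>t. cnj (\<phi> t) *s H t"]
    by simp
  also have "\<dots> = (\<Sum>t\<in>max_subgroup x. cnj (\<phi> s) *s (cnj (\<phi> t) *s H (t * s)))"
    using assms by (intro sum.cong) (auto simp: character_mult mult.commute)
  finally have *: "\<phi> s *s (\<Sum>t\<in>max_subgroup x. cnj (\<phi> t) *s H t)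
      = (\<Sum>t\<in>max_subgroup x. cnj (\<phi> t) *s H (t * s))"
    using character_cnj_mult[OF assms] by (simp add: vec.scale_sum_right mult.assoc[symmetric])
  show ?thesis
    unfolding E_char_def prod.case star_scale_left star_sum_left H_star_H *[symmetric]
    by (rule vec.scale_left_commute)
qed

lemma E_char_star_eigenvector:
  fixes x :: "'a::left_regular_band_of_groups"
  assumes "x \<in> Idem" "\<phi> \<in> characters x"
    and "\<And>s. s \<in> max_subgroup x \<Longrightarrow> H s \<star> w = \<phi> s *s w"
  shows "E_char (x, \<phi>) \<star> w = w"
proof -
  have "(\<Sum>s\<in>max_subgroup x. cnj (\<phi> s) *s (H s \<star> w)) = (\<Sum>s\<in>max_subgroup x. w)"
    using assms character_cnj_mult[OF assms(1,2)] by (intro sum.cong) (auto simp: mult.commute)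
  also have "\<dots> = of_nat (card (max_subgroup x)) *s w"
    by (simp only: vec_eq_iff sum_component vector_smult_component) simp
  finally show ?thesis
    using card_max_subgroup_pos[OF assms(1)]
    by (auto simp: E_char_def star_scale_left star_sum_left)
qed

lemma E_char_idem:
  fixes x :: "'a::left_regular_band_of_groups"
  assumes "x \<in> Idem" "\<phi> \<in> characters x"
  shows "E_char (x, \<phi>) \<star> E_char (x, \<phi>) = E_char (x, \<phi>)"
  using assms H_star_E_char by (intro E_char_star_eigenvector) auto

text \<open>Take \<open>s\<close> separating the two characters: an \<open>H s\<close> placed
  between the factors can be evaluated to the left as \<open>\<phi> s\<close> and to the right as
  \<open>\<psi> s\<close>.\<close>

lemma E_char_orthogonal:
  fixes x :: "'a::left_regular_band_of_groups"
  assumes "x \<in> Idem" "\<phi> \<in> characters x" "\<psi> \<in> characters x" "\<phi> \<noteq> \<psi>"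
  shows "E_char (x, \<phi>) \<star> E_char (x, \<psi>) = 0"
proof -
  obtain s where s: "s \<in> max_subgroup x" "\<phi> s \<noteq> \<psi> s"
    using assms(2-4) unfolding characters_def by (metis (no_types, lifting) PiE_ext mem_Collect_eq)
  have "\<phi> s *s (E_char (x, \<phi>) \<star> E_char (x, \<psi>)) = E_char (x, \<phi>) \<star> H s \<star> E_char (x, \<psi>)"
    using assms s by (simp add: E_char_star_H star_scale_left)
  also have "\<dots> = \<psi> s *s (E_char (x, \<phi>) \<star> E_char (x, \<psi>))"
    using assms s by (simp add: H_star_E_char star_scale_right star_assoc)
  finally show ?thesis using s(2) by (simp add: vec.scale_cancel_right)
qed

lemma E_char_unit:
  fixes x :: "'a::left_regular_band_of_groups"
  assumes "x \<in> Idem" "\<phi> \<in> characters x"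
  shows "H x \<star> E_char (x, \<phi>) = E_char (x, \<phi>)" "E_char (x, \<phi>) \<star> H x = E_char (x, \<phi>)"
  using H_star_E_char[OF assms Idem_in_max_subgroup[OF assms(1)]]
    E_char_star_H[OF assms Idem_in_max_subgroup[OF assms(1)]] character_unit[OF assms]
  by simp_all

lemma E_char_nth:
  "E_char (x, \<phi>) $ s = (if s \<in> max_subgroup x then cnj (\<phi> s) / of_nat (card (max_subgroup x)) else 0)"
proof -
  have "(\<Sum>t\<in>max_subgroup x. cnj (\<phi> t) * (if s = t then 1 else 0))
      = (\<Sum>t\<in>max_subgroup x. if s = t then cnj (\<phi> t) else 0)"
    by (intro sum.cong) auto
  then show ?thesis by (simp add: E_char_def H_nth sum_component)
qed

lemma E_char_nonzero:
  fixes x :: "'a::left_regular_band_of_groups"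
  assumes "x \<in> Idem" "\<phi> \<in> characters x"
  shows "E_char (x, \<phi>) \<noteq> 0"
proof
  assume "E_char (x, \<phi>) = 0"
  then have "E_char (x, \<phi>) $ x = 0" by simp
  then show False
    using card_max_subgroup_pos[OF assms(1)] Idem_in_max_subgroup[OF assms(1)]
    by (simp add: E_char_nth character_unit[OF assms])
qed

section \<open>Diagonalising left multiplication by group elements, and the resolution of
  \<open>H x\<close> into character idempotents\<close>

lemma H_star_funpow: "((\<star>) (H a) ^^ Suc n) w = H (((*) a ^^ n) a) \<star> w"
  by (induction n) (simp_all add: star_assoc[symmetric] H_star_H)

lemma sum_powers_root_of_unity:
  fixes \<eta> :: complex
  assumes "\<eta> ^ n = 1" "\<eta> \<noteq> 1"
  shows "(\<Sum>j<n. \<eta> ^ j) = 0"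
  using assms by (simp add: geometric_sum)

text \<open>An operator of finite order is diagonalised by the discrete Fourier transform along its orbits.\<close>

lemma finite_order_eigen_decomposition:
  fixes w :: "('a::{semigroup_mult,finite}) alg"
  assumes "0 < n" "((\<star>) (H a) ^^ n) w = w"
  obtains p :: "nat \<Rightarrow> 'a alg" and c d
  where "w = (\<Sum>j<n. p j)" "\<And>j. H a \<star> p j = c j *s p j"
    "\<And>j. p j = (\<Sum>k<n. d j k *s ((\<star>) (H a) ^^ k) w)"
proof -
  \<comment> \<open>A primitive \<open>n\<close>-th root of unity. The Fourier component
    \<open>p j\<close> below has eigenvalue \<open>inverse (\<eta> ^ j)\<close>.\<close>
  define \<eta> where "\<eta> = exp (2 * of_real pi * \<i> * of_nat 1 / of_nat n)"
  have \<eta>n: "\<eta> ^ n = 1" unfolding \<eta>_def using assms(1) by (intro complex_root_unity) simp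
  have \<eta>0: "\<eta> \<noteq> 0" by (simp add: \<eta>_def)
  have \<eta>1: "\<eta> ^ k \<noteq> 1" if "0 < k" "k < n" for k
  proof -
    have "\<eta> ^ k = exp (2 * of_real pi * \<i> * of_nat k / of_nat n)"
      by (simp add: \<eta>_def exp_of_nat_mult[symmetric] mult_ac)
    then show ?thesis using complex_root_unity_eq_1[of n k] that by (auto dest: dvd_imp_le)
  qed
  define W where "W k = ((\<star>) (H a) ^^ k) w" for k
  define p where "p j = (\<Sum>k<n. (1 / of_nat n * \<eta> ^ (j * k)) *s W k)" for j
  have "(\<Sum>j<n. p j) = (\<Sum>k<n. (\<Sum>j<n. 1 / of_nat n * \<eta> ^ (j * k)) *s W k)"
    unfolding p_def by (subst sum.swap) (simp add: vec.scale_sum_left)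
  also have "\<dots> = (\<Sum>k<n. if k = 0 then w else 0)"
  proof (intro sum.cong refl)
    fix k assume "k \<in> {..<n}"
    then have k: "k < n" by simp
    have "(\<eta> ^ k) ^ n = 1" by (metis \<eta>n mult.commute power_mult power_one)
    then have "(\<Sum>j<n. (\<eta> ^ k) ^ j) = (if k = 0 then of_nat n else 0)"
      using \<eta>1[of k] k sum_powers_root_of_unity[of "\<eta> ^ k" n] by auto
    moreover have "\<eta> ^ (j * k) = (\<eta> ^ k) ^ j" for j
      by (metis mult.commute power_mult)
    ultimately have "(\<Sum>j<n. 1 / of_nat n * \<eta> ^ (j * k)) = (if k = 0 then 1 else 0)"
      using assms(1) by (simp only: sum_distrib_left[symmetric]) simp
    then show "(\<Sum>j<n. 1 / of_nat n * \<eta> ^ (j * k)) *s W k = (if k = 0 then w else 0)"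
      by (simp add: W_def)
  qed
  also have "\<dots> = w" using assms(1) by simp
  finally have sum: "w = (\<Sum>j<n. p j)" by simp
  have eig: "H a \<star> p j = inverse (\<eta> ^ j) *s p j" for j
  proof -
    define g where "g k = (1 / of_nat n * \<eta> ^ (j * k)) *s W k" for k
    have "(\<eta> ^ j) *s (H a \<star> p j) = (\<Sum>k<n. g (Suc k))"
      by (simp add: p_def g_def W_def star_sum_right star_scale_right vec.scale_sum_right power_add mult_ac)
    \<comment> \<open>Both \<open>W\<close> and the powers of \<open>\<eta>\<close> return after
      \<open>n\<close> steps, so shifting the index only trades \<open>g 0\<close> for the equal
      term \<open>g n\<close>.\<close>
    moreover have "(\<Sum>k<n. g (Suc k)) = (\<Sum>k<n. g k)"
    proof -
      have "g n = g 0" using assms(2) \<eta>n by (simp add: g_def W_def mult.commute[of j] power_mult)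
      then show ?thesis using sum.lessThan_Suc_shift[of g n] by simp
    qed
    ultimately have "(\<eta> ^ j) *s (H a \<star> p j) = p j" by (simp add: g_def p_def)
    then have "inverse (\<eta> ^ j) *s p j = (inverse (\<eta> ^ j) * \<eta> ^ j) *s (H a \<star> p j)"
      by (metis vec.scale_scale)
    then show ?thesis using \<eta>0 by simp
  qed
  show ?thesis
    by (rule that[OF sum eig]) (simp add: p_def W_def)
qed

text \<open>The set \<open>B\<close> is a parameter because the induction below adds group elements
  one at a time. The eigenvalues are left free to vary with \<open>w\<close>.\<close>

definition eigenvectors :: "'a \<Rightarrow> 'a set \<Rightarrow> ('a::{semigroup_mult,finite}) alg set"
  where "eigenvectors x B = {w. H x \<star> w = w \<and> (\<forall>b\<in>B. \<exists>c. H b \<star> w = c *s w)}"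

text \<open>The components of an eigenvector \<open>w\<close> under \<open>H a\<close> are
  combinations of iterates of \<open>H a\<close> on \<open>w\<close>. Any \<open>b\<close> commuting
  with \<open>a\<close> keeps its eigenvalue on all of them, so adding \<open>a\<close> to
  \<open>B\<close> refines the eigenvectors without losing anything from the span.\<close>

lemma eigenvectors_span:
  fixes x :: "'a::left_regular_band_of_abelian_groups"
  assumes x: "x \<in> Idem" and B: "B \<subseteq> max_subgroup x" and f: "H x \<star> f = f"
  shows "f \<in> vec.span (eigenvectors x B)"
  using finite[of B] B
proof (induction B rule: finite_induct)
  case empty
  then show ?case using f by (intro vec.span_base) (simp add: eigenvectors_def)
next
  case (insert a B)
  have a: "a \<in> max_subgroup x" using insert.prems by simp
  have "w \<in> vec.span (eigenvectors x (insert a B))" if w: "w \<in> eigenvectors x B" for w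
  proof -
    \<comment> \<open>\<open>x\<close> is a product of \<open>n + 1\<close> copies of
      \<open>a\<close>, so \<open>Suc n\<close> applications of \<open>H a\<close> fix
      \<open>w\<close>.\<close>
    obtain n where n: "x = ((*) a ^^ n) a" using omega_power[of a] a by (metis max_subgroup_iff)
    have "((\<star>) (H a) ^^ Suc n) w = w"
      using w unfolding H_star_funpow n[symmetric] by (simp add: eigenvectors_def)
    then obtain p c d where p: "w = (\<Sum>j<Suc n. p j)" "\<And>j. H a \<star> p j = c j *s p j"
      "\<And>j. p j = (\<Sum>k<Suc n. d j k *s ((\<star>) (H a) ^^ k) w)"
      using finite_order_eigen_decomposition[of "Suc n" a w] by blast
    have comm: "H b \<star> p j = e *s p j" if b: "b \<in> max_subgroup x" "H b \<star> w = e *s w" for b e j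
    proof -
      have ba: "b * a = a * b"
        using a b(1) x max_subgroup_commute[of x b a] by (simp add: max_subgroup_iff Idem_def)
      have "H b \<star> ((\<star>) (H a) ^^ k) w = e *s ((\<star>) (H a) ^^ k) w" for k
      proof (induction k)
        case (Suc k)
        have "H b \<star> ((\<star>) (H a) ^^ Suc k) w = H a \<star> (H b \<star> ((\<star>) (H a) ^^ k) w)"
          by (simp add: star_assoc[symmetric] H_star_H ba)
        then show ?case using Suc by (simp add: star_scale_right)
      qed (use b in simp)
      then show ?thesis
        unfolding p(3) by (simp add: star_sum_right star_scale_right vec.scale_sum_right mult.commute del: sum.lessThan_Suc)
    qed
    have "p j \<in> eigenvectors x (insert a B)" for j
    proof -
      \<comment> \<open>Being fixed by \<open>H x\<close> is read as an eigenvalue equation with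
        eigenvalue \<open>1\<close>, so that \<open>comm\<close> covers it.\<close>
      have "H x \<star> p j = 1 *s p j"
        using w Idem_in_max_subgroup[OF x] by (intro comm) (simp_all add: eigenvectors_def)
      moreover have "\<exists>e. H b \<star> p j = e *s p j" if "b \<in> B" for b
        using w that insert.prems comm[of b] unfolding eigenvectors_def by blast
      ultimately show ?thesis using p(2) by (auto simp: eigenvectors_def)
    qed
    then show ?thesis unfolding p(1) by (intro vec.span_sum vec.span_base)
  qed
  then have "eigenvectors x B \<subseteq> vec.span (eigenvectors x (insert a B))" by blast
  then show ?case
    using insert vec.span_minimal[OF _ vec.subspace_span] by blast
qed

text \<open>The eigenvalues on a nonzero \<open>w\<close> form a character. Its idempotent fixes
  \<open>w\<close>, and the others kill \<open>w\<close> by orthogonality.\<close>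

lemma sum_E_char_star_eigenvector:
  fixes x :: "'a::left_regular_band_of_groups"
  assumes x: "x \<in> Idem" and w: "w \<in> eigenvectors x (max_subgroup x)"
  shows "(\<Sum>\<phi>\<in>characters x. E_char (x, \<phi>)) \<star> w = w"
proof (cases "w = 0")
  case False
  have xw: "H x \<star> w = w" using w by (simp add: eigenvectors_def)
  obtain c where c: "\<And>s. s \<in> max_subgroup x \<Longrightarrow> H s \<star> w = c s *s w"
    using w unfolding eigenvectors_def by (simp, metis)
  have mult: "c (s * t) = c s * c t" if "s \<in> max_subgroup x" "t \<in> max_subgroup x" for s t
  proof -
    have "c (s * t) *s w = H s \<star> (H t \<star> w)"
      using c[OF max_subgroup_mult[OF that]] by (simp add: star_assoc[symmetric] H_star_H)
    also have "\<dots> = (c s * c t) *s w" using that by (simp add: c star_scale_right mult.commute)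
    finally show ?thesis using False by simp
  qed
  have "c x *s w = 1 *s w" using c[OF Idem_in_max_subgroup[OF x]] xw by simp
  then have cx: "c x = 1" using False by (metis vec.scale_right_imp_eq)
  have nz: "c s \<noteq> 0" if s: "s \<in> max_subgroup x" for s
  proof -
    obtain s' where "s' \<in> max_subgroup x" "s' * s = x" using max_subgroup_inverse[OF s] .
    then show ?thesis using mult[of s' s] s cx by auto
  qed
  define \<phi> where "\<phi> = restrict c (max_subgroup x)"
  have \<phi>: "\<phi> \<in> characters x"
    using mult nz by (auto simp: characters_def \<phi>_def max_subgroup_mult)
  have Ew: "E_char (x, \<phi>) \<star> w = w"
    using x \<phi> c by (intro E_char_star_eigenvector) (auto simp: \<phi>_def)
  have "(\<Sum>\<psi>\<in>characters x. E_char (x, \<psi>) \<star> w) = (\<Sum>\<psi>\<in>characters x. if \<psi> = \<phi> then w else 0)"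
  proof (intro sum.cong refl)
    fix \<psi> assume \<psi>: "\<psi> \<in> characters x"
    have "E_char (x, \<psi>) \<star> w = E_char (x, \<psi>) \<star> E_char (x, \<phi>) \<star> w" by (simp add: star_assoc Ew)
    then show "E_char (x, \<psi>) \<star> w = (if \<psi> = \<phi> then w else 0)"
      using Ew E_char_orthogonal[OF x \<psi> \<phi>] by auto
  qed
  then show ?thesis using \<phi> finite_characters[OF x] by (simp add: star_sum_left)
qed simp

text \<open>The vectors fixed by left multiplication with the sum form a subspace that contains all
  simultaneous eigenvectors, hence \<open>H x\<close>. Conversely \<open>H x\<close> is a right unit
  for every summand. No count of the characters is involved.\<close>

lemma sum_E_char:
  fixes x :: "'a::left_regular_band_of_abelian_groups"
  assumes x: "x \<in> Idem"
  shows "(\<Sum>\<phi>\<in>characters x. E_char (x, \<phi>)) = H x"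
proof -
  let ?F = "\<Sum>\<phi>\<in>characters x. E_char (x, \<phi>)"
  have "H x \<in> vec.span (eigenvectors x (max_subgroup x))"
    using x by (intro eigenvectors_span) (auto simp: H_star_H Idem_mult_self)
  also have "\<dots> \<subseteq> {w. ?F \<star> w = w}"
    using sum_E_char_star_eigenvector[OF x]
    by (intro vec.span_minimal) (auto simp: vec.subspace_def star_add_right star_scale_right)
  finally have "?F \<star> H x = H x" by simp
  then show ?thesis using x by (simp add: star_sum_left E_char_unit)
qed

section \<open>The elements attached to characters\<close>

text \<open>A splitting \<open>q = f + g\<close> into orthogonal idempotents gives
  \<open>f = q \<star> f \<star> q\<close>, a multiple of \<open>q\<close>; idempotency leaves only
  the scalars \<open>0\<close> and \<open>1\<close>.\<close>

lemma primitive_idempotentI: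
  assumes "q \<noteq> 0" "q \<star> q = q" "\<And>a. \<exists>c. q \<star> a \<star> q = c *s q"
  shows "primitive_idempotent q"
  unfolding primitive_idempotent_def
proof (intro conjI assms allI impI)
  fix f g
  assume h: "f \<star> f = f" "g \<star> g = g" "f \<star> g = 0" "g \<star> f = 0" "q = f + g"
  obtain c where "q \<star> f \<star> q = c *s q" using assms(3) by blast
  moreover have "q \<star> f \<star> q = f" using h by (simp add: star_add_left star_add_right)
  ultimately have f: "f = c *s q" by simp
  have "(c * c) *s q = c *s q" using h(1) assms(2) unfolding f by (simp add: star_scale_left star_scale_right)
  then have "c = 0 \<or> c = 1" using assms(1) by (metis mult_cancel_left1 vec.scale_right_imp_eq)
  then show "f = 0 \<or> g = 0" using f h(5) by auto
qed

lemma is_basis_familyI: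
  assumes fin: "finite I"
    and lin: "\<And>c i. (\<Sum>j\<in>I. c j *s b j) = 0 \<Longrightarrow> i \<in> I \<Longrightarrow> c i = 0"
    and span: "vec.span (b ` I) = UNIV"
  shows "is_basis_family I b"
proof -
  have inj: "inj_on b I"
  proof (rule inj_onI, rule ccontr)
    fix i j assume ij: "i \<in> I" "j \<in> I" "b i = b j" "i \<noteq> j"
    \<comment> \<open>Two indices with the same vector would satisfy this nontrivial
      relation.\<close>
    define c where "c k = (if k = i then 1 else if k = j then - 1 else 0 :: complex)" for k
    have "(\<Sum>k\<in>I. c k *s b k) = (\<Sum>k\<in>I. (if k = i then b i else 0) - (if k = j then b j else 0))"
      using ij(4) by (intro sum.cong) (auto simp: c_def)
    also have "\<dots> = 0" using fin ij by (simp add: sum_subtractf)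
    finally show False using lin[of c i] ij by (simp add: c_def)
  qed
  have "vec.independent (b ` I)"
  proof (rule vec.independent_if_scalars_zero)
    fix f v assume f: "(\<Sum>v\<in>b ` I. f v *s v) = 0" and "v \<in> b ` I"
    then obtain i where i: "i \<in> I" "v = b i" by blast
    have "(\<Sum>j\<in>I. f (b j) *s b j) = 0" using f by (simp add: sum.reindex[OF inj])
    then show "f v = 0" using lin[of "\<lambda>j. f (b j)"] i by simp
  qed (use fin in simp)
  then show ?thesis using inj span by (simp add: is_basis_family_def)
qed

section \<open>Equivalence of characters at idempotents of equal support\<close>

lemma char_sim_iff:
  fixes x y :: "'a::left_regular_band_of_groups"
  shows "((x, \<phi>), (y, \<psi>)) \<in> char_sim \<longleftrightarrow>
    x \<in> Idem \<and> y \<in> Idem \<and> supp x = supp y \<and> \<phi> \<in> characters x \<and> \<psi> \<in> characters y \<and>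
    (\<forall>s\<in>max_subgroup x. \<phi> s = \<psi> (y * s))"
proof -
  have "\<phi> = compose (max_subgroup x) \<psi> ((*) y) \<longleftrightarrow> (\<forall>s\<in>max_subgroup x. \<phi> s = \<psi> (y * s))"
    if "\<phi> \<in> characters x"
  proof
    assume "\<phi> = compose (max_subgroup x) \<psi> ((*) y)"
    then show "\<forall>s\<in>max_subgroup x. \<phi> s = \<psi> (y * s)" by (metis compose_eq)
  next
    assume "\<forall>s\<in>max_subgroup x. \<phi> s = \<psi> (y * s)"
    moreover have "\<phi> \<in> extensional (max_subgroup x)" using that by (simp add: characters_def PiE_iff)
    ultimately show "\<phi> = compose (max_subgroup x) \<psi> ((*) y)"
      by (intro extensionalityI[where A = "max_subgroup x"]) (auto simp: compose_eq)
  qed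
  moreover have "sim x y \<longleftrightarrow> supp x = supp y" if "x \<in> Idem" "y \<in> Idem"
    using that by (simp add: sim_Idem_iff supp_Idem_eq_iff)
  ultimately show ?thesis
    unfolding char_sim_def S_hat_def by (simp, metis)
qed

lemma max_subgroup_change:
  fixes x y :: "'a::left_regular_band_of_groups"
  assumes "x \<in> Idem" "y \<in> Idem" "supp x = supp y" "s \<in> max_subgroup x"
  shows "y * s \<in> max_subgroup y"
  using bij_betwE[OF max_subgroup_change_bij[OF assms(1-3)]] assms(4) by blast

lemma mult_change:
  fixes x y z s :: "'a::left_regular_band_of_groups"
  assumes "y \<in> Idem" "z \<in> Idem" "supp y = supp z"
  shows "z * (y * s) = z * s"
  using mult_supp_eq[OF assms(2,1)] assms(3) by (simp add: mult.assoc[symmetric])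

lemma equiv_char_sim:
  "equiv (S_hat :: ('a::left_regular_band_of_groups \<times> ('a \<Rightarrow> complex)) set) char_sim"
proof (rule equivI)
  show "char_sim \<subseteq> S_hat \<times> (S_hat :: ('a \<times> ('a \<Rightarrow> complex)) set)"
    by (auto simp: char_sim_def)
  show "refl_on S_hat (char_sim :: (('a \<times> ('a \<Rightarrow> complex)) \<times> ('a \<times> ('a \<Rightarrow> complex))) set)"
    by (rule refl_onI) (auto simp: S_hat_def char_sim_iff max_subgroup_left_unit)
  show "sym (char_sim :: (('a \<times> ('a \<Rightarrow> complex)) \<times> ('a \<times> ('a \<Rightarrow> complex))) set)"
  proof (rule symI, clarify)
    fix x y :: 'a and \<phi> \<psi> :: "'a \<Rightarrow> complex"
    assume h: "((x, \<phi>), (y, \<psi>)) \<in> char_sim"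
    have "\<psi> t = \<phi> (x * t)" if "t \<in> max_subgroup y" for t
      using h that max_subgroup_change[of y x t] mult_change[of x y t] max_subgroup_left_unit[OF that]
      by (simp add: char_sim_iff)
    then show "((y, \<psi>), (x, \<phi>)) \<in> char_sim" using h by (simp add: char_sim_iff)
  qed
  show "trans (char_sim :: (('a \<times> ('a \<Rightarrow> complex)) \<times> ('a \<times> ('a \<Rightarrow> complex))) set)"
  proof (rule transI, clarify)
    fix x y z :: 'a and \<phi> \<psi> \<theta> :: "'a \<Rightarrow> complex"
    assume h: "((x, \<phi>), (y, \<psi>)) \<in> char_sim" "((y, \<psi>), (z, \<theta>)) \<in> char_sim"
    have "\<phi> s = \<theta> (z * s)" if "s \<in> max_subgroup x" for s
      using h that max_subgroup_change[of x y s] mult_change[of y z s]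
      by (simp add: char_sim_iff)
    then show "((x, \<phi>), (z, \<theta>)) \<in> char_sim" using h by (simp add: char_sim_iff)
  qed
qed

text \<open>Since \<open>y * s * y = y * s\<close>, translation by \<open>y\<close> is
  multiplicative and pulls characters back to characters. Hence a class has a member at every
  idempotent of its support.\<close>

lemma character_pullback:
  fixes x y :: "'a::left_regular_band_of_groups"
  assumes "x \<in> Idem" "y \<in> Idem" "supp x = supp y" "\<psi> \<in> characters y"
  shows "((x, restrict (\<lambda>s. \<psi> (y * s)) (max_subgroup x)), (y, \<psi>)) \<in> char_sim"
proof -
  have "\<psi> (y * (s * t)) = \<psi> (y * s) * \<psi> (y * t)" if "s \<in> max_subgroup x" "t \<in> max_subgroup x" for s t
  proof -
    have "y * (s * t) = y * s * y * t"
      unfolding Idem_lrb[OF assms(2)] by (rule mult.assoc[symmetric])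
    also have "\<dots> = y * s * (y * t)" by (rule mult.assoc)
    finally show ?thesis
      using character_mult[OF assms(4)] max_subgroup_change[OF assms(1-3)] that by simp
  qed
  moreover have "\<psi> (y * s) \<noteq> 0" if "s \<in> max_subgroup x" for s
    using character_nonzero[OF assms(4)] max_subgroup_change[OF assms(1-3)] that by simp
  ultimately have "restrict (\<lambda>s. \<psi> (y * s)) (max_subgroup x) \<in> characters x"
    by (auto simp: characters_def max_subgroup_mult)
  then show ?thesis using assms by (simp add: char_sim_iff)
qed

lemma finite_S_hat: "finite (S_hat :: ('a::left_regular_band_of_groups \<times> ('a \<Rightarrow> complex)) set)"
  unfolding S_hat_def by (intro finite_SigmaI) (auto intro: finite_characters)

text \<open>\<open>z\<close> absorbs \<open>y\<close>, so corresponding elements of the two groups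
  have the same translate by \<open>z\<close>. This is the source of the independence of
  \<open>e_char\<close> from the representative.\<close>

lemma H_star_E_char_cong:
  fixes x y z :: "'a::left_regular_band_of_groups"
  assumes sim: "((x, \<phi>), (y, \<psi>)) \<in> char_sim" and z: "z \<in> Idem" "supp z = supp x"
  shows "H z \<star> E_char (x, \<phi>) = H z \<star> E_char (y, \<psi>)"
proof -
  have xy: "x \<in> Idem" "y \<in> Idem" "supp x = supp y"
    and \<phi>: "\<And>s. s \<in> max_subgroup x \<Longrightarrow> \<phi> s = \<psi> (y * s)"
    using sim by (auto simp: char_sim_iff)
  note bij = max_subgroup_change_bij[OF xy]
  have "(\<Sum>s\<in>max_subgroup x. cnj (\<phi> s) *s H (z * s))
      = (\<Sum>s\<in>max_subgroup x. cnj (\<psi> (y * s)) *s H (z * (y * s)))"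
    using \<phi> mult_change[OF xy(2) z(1)] z(2) xy(3) by (intro sum.cong) auto
  also have "\<dots> = (\<Sum>t\<in>max_subgroup y. cnj (\<psi> t) *s H (z * t))"
    by (rule sum.reindex_bij_betw[OF bij])
  finally show ?thesis
    using bij_betw_same_card[OF bij]
    by (simp add: E_char_def star_scale_right star_sum_right H_star_H)
qed

section \<open>The elements \<open>Q_char\<close>: left action, corners and leading
  coefficients\<close>

lemma Q_char_eq:
  assumes "x \<in> Idem" "\<phi> \<in> characters x"
  shows "Q_char u (x, \<phi>) = E_char (x, \<phi>) \<star> e_circ u (supp x)"
  by (simp add: Q_char_def Q_circ_def star_assoc[symmetric] E_char_unit[OF assms])

context
  fixes u :: "'a::left_regular_band_of_groups set \<Rightarrow> 'a alg"
  assumes hs: "homogeneous_section u"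
begin

text \<open>\<open>homogeneous_section_star\<close> asks for a value that does not vary with
  \<open>x\<close>, so it is applied to \<open>f - g\<close> with value \<open>0\<close>.\<close>

lemma homogeneous_section_star_cong:
  assumes "X \<in> Idem_supp" "\<And>x. x \<in> Idem \<Longrightarrow> supp x = X \<Longrightarrow> H x \<star> f = H x \<star> g"
  shows "u X \<star> f = u X \<star> g"
proof -
  have "u X \<star> (f - g) = 0"
    using assms by (intro homogeneous_section_star[OF hs]) (auto simp: star_diff_right)
  then show ?thesis by (simp add: star_diff_right)
qed

lemma H_Idem_star_homogeneous_section:
  assumes "x \<in> Idem"
  shows "H x \<star> u (supp x) = H x"
  using assms supp_in_Idem_supp[OF assms]
  by (intro H_star_homogeneous_section[OF hs]) (auto simp: mult_omega_self level_Idem intro: supp_le_refl)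

text \<open>Each \<open>H z\<close> of this support absorbs both \<open>H x\<close> and
  \<open>u (supp x)\<close>, so the two are interchangeable to the right of
  \<open>u (supp x)\<close>.\<close>

lemma homogeneous_section_star_H:
  assumes "x \<in> Idem"
  shows "u (supp x) \<star> H x = u (supp x)"
proof -
  have "u (supp x) \<star> H x = u (supp x) \<star> u (supp x)"
  proof (rule homogeneous_section_star_cong[OF supp_in_Idem_supp[OF assms]])
    fix z :: 'a assume z: "z \<in> Idem" "supp z = supp x"
    then show "H z \<star> H x = H z \<star> u (supp x)"
      using H_Idem_star_homogeneous_section[OF z(1)] mult_supp_eq[OF z(1) assms] by (simp add: H_star_H)
  qed
  then show ?thesis using homogeneous_section_idem[OF hs supp_in_Idem_supp[OF assms]] by simp
qed

lemma e_circ_star_e_circ: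
  assumes "X \<in> Idem_supp" "Y \<in> Idem_supp"
  shows "e_circ u X \<star> e_circ u Y = (if X = Y then e_circ u X else 0)"
  using e_circ_star_same[OF hs assms(1)] e_circ_star_different[OF hs assms]
    e_circ_annihilated_above[OF hs] homogeneous_section_star_e_circ[OF hs] assms
  by auto

context
  fixes x :: 'a and \<phi> :: "'a \<Rightarrow> complex"
  assumes x: "x \<in> Idem" and \<phi>: "\<phi> \<in> characters x"
begin

lemma E_char_star_homogeneous_section:
  "E_char (x, \<phi>) \<star> u (supp x) = E_char (x, \<phi>)"
  using E_char_unit(2)[OF x \<phi>] H_Idem_star_homogeneous_section[OF x] by (metis star_assoc)

lemma Q_char_annihilated_above: "annihilated_above (supp x) (Q_char u (x, \<phi>))"
  unfolding Q_char_eq[OF x \<phi>]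
  using x by (intro annihilated_above_star e_circ_annihilated_above[OF hs] supp_in_Idem_supp)

lemma Q_char_star:
  assumes "annihilated_above (supp x) w"
  shows "Q_char u (x, \<phi>) \<star> w = E_char (x, \<phi>) \<star> w"
proof -
  have "Q_char u (x, \<phi>) \<star> w = E_char (x, \<phi>) \<star> (u (supp x) \<star> w)"
    by (simp add: Q_char_eq[OF x \<phi>] star_assoc e_circ_star_same[OF hs supp_in_Idem_supp[OF x] assms])
  then show ?thesis by (simp add: star_assoc[symmetric] E_char_star_homogeneous_section)
qed

lemma Q_char_idem: "Q_char u (x, \<phi>) \<star> Q_char u (x, \<phi>) = Q_char u (x, \<phi>)"
  unfolding Q_char_star[OF Q_char_annihilated_above]
  by (simp add: Q_char_eq[OF x \<phi>] star_assoc[symmetric] E_char_idem[OF x \<phi>])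

text \<open>The left \<open>Q_char\<close> acts as the character idempotent, so it suffices to treat
  \<open>a = H s\<close>. Either the level of \<open>s\<close> is not below \<open>supp x\<close>
  and \<open>H s\<close> kills the right factor, or \<open>x * s\<close> lies in the group at
  \<open>x\<close> and is evaluated by \<open>\<phi>\<close>.\<close>

lemma Q_char_corner: "\<exists>c. Q_char u (x, \<phi>) \<star> a \<star> Q_char u (x, \<phi>) = c *s Q_char u (x, \<phi>)"
proof -
  let ?Q = "Q_char u (x, \<phi>)"
  have EH: "E_char (x, \<phi>) \<star> (H s \<star> ?Q) = (if supp_le (level s) (supp x) then \<phi> (x * s) else 0) *s ?Q" for s
  proof (cases "supp_le (level s) (supp x)")
    case True
    have "E_char (x, \<phi>) \<star> H s = E_char (x, \<phi>) \<star> H x \<star> H s"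
      by (simp add: E_char_unit[OF x \<phi>])
    also have "\<dots> = \<phi> (x * s) *s E_char (x, \<phi>)"
      using E_char_star_H[OF x \<phi> mult_Idem_in_max_subgroup[OF x True]] by (simp add: star_assoc H_star_H)
    finally have "E_char (x, \<phi>) \<star> H s = \<phi> (x * s) *s E_char (x, \<phi>)" .
    then have "E_char (x, \<phi>) \<star> (H s \<star> ?Q) = \<phi> (x * s) *s (E_char (x, \<phi>) \<star> ?Q)"
      by (simp add: star_assoc[symmetric] star_scale_left)
    also have "E_char (x, \<phi>) \<star> ?Q = ?Q"
      by (simp add: Q_char_eq[OF x \<phi>] star_assoc[symmetric] E_char_idem[OF x \<phi>])
    finally show ?thesis using True by simp
  next
    case False
    then show ?thesis using Q_char_annihilated_above by (simp add: annihilated_above_def)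
  qed
  have "?Q \<star> a \<star> ?Q = E_char (x, \<phi>) \<star> (a \<star> ?Q)"
    unfolding star_assoc
    by (intro Q_char_star annihilated_above_star Q_char_annihilated_above supp_in_Idem_supp x)
  also have "\<dots> = (\<Sum>s\<in>UNIV. a $ s *s (E_char (x, \<phi>) \<star> (H s \<star> ?Q)))"
    unfolding star_H_expansion_left[of a] by (simp add: star_sum_right star_scale_right)
  also have "\<dots> = (\<Sum>s\<in>UNIV. a $ s * (if supp_le (level s) (supp x) then \<phi> (x * s) else 0)) *s ?Q"
    unfolding EH by (simp only: vec.scale_scale vec.scale_sum_left)
  finally show ?thesis by blast
qed

text \<open>The two elements differ by products ending in \<open>e_circ u Y\<close> with
  \<open>Y\<close> strictly above \<open>supp x\<close>, whose coefficients sit at levels above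
  \<open>Y\<close>. Nonvanishing and linear independence are read off at the level
  \<open>supp x\<close>.\<close>

lemma Q_char_nth:
  assumes "level s = supp x"
  shows "Q_char u (x, \<phi>) $ s = E_char (x, \<phi>) $ s"
proof -
  note X = supp_in_Idem_supp[OF x]
  have "(E_char (x, \<phi>) \<star> e_circ u Y) $ s = 0" if Y: "Y \<in> Idem_supp" "supp_less (supp x) Y" for Y
  proof (rule ccontr)
    assume "(E_char (x, \<phi>) \<star> e_circ u Y) $ s \<noteq> 0"
    then obtain r t where t: "e_circ u Y $ t \<noteq> 0" "s = r * t" by (rule star_nth_nonzeroE)
    have "supp_le Y (level t)" using e_circ_nth[OF hs Y(1) t(1)] by (simp add: level_Idem)
    then have "supp_le Y (supp x)"
      using supp_le_trans[OF Y(1) _ X, of "level t"] level_mult_ge2[of t r] t(2) assms by simp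
    then show False using Y supp_le_antisym[OF X Y(1)] by (auto simp: supp_less_def)
  qed
  moreover have "Q_char u (x, \<phi>) = E_char (x, \<phi>)
      - (\<Sum>Y | Y \<in> Idem_supp \<and> supp_less (supp x) Y. E_char (x, \<phi>) \<star> e_circ u Y)"
    unfolding Q_char_eq[OF x \<phi>] e_circ_rec[OF X]
    by (simp add: star_diff_right star_sum_right star_assoc[symmetric] E_char_star_homogeneous_section)
  ultimately show ?thesis by (simp add: sum_component)
qed

lemma Q_char_nonzero: "Q_char u (x, \<phi>) \<noteq> 0"
proof
  assume "Q_char u (x, \<phi>) = 0"
  then have "E_char (x, \<phi>) $ x = 0" using Q_char_nth[of x] x by (simp add: level_Idem)
  then show False
    using card_max_subgroup_pos[OF x] Idem_in_max_subgroup[OF x]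
    by (simp add: E_char_nth character_unit[OF x \<phi>])
qed

lemma primitive_Q_char: "primitive_idempotent (Q_char u (x, \<phi>))"
  using Q_char_nonzero Q_char_idem Q_char_corner by (rule primitive_idempotentI)

lemma Q_char_star_e_circ:
  assumes "Y \<in> Idem_supp"
  shows "Q_char u (x, \<phi>) \<star> e_circ u Y = (if supp x = Y then Q_char u (x, \<phi>) else 0)"
  using assms by (simp add: Q_char_eq[OF x \<phi>] star_assoc e_circ_star_e_circ supp_in_Idem_supp[OF x])

text \<open>All members of the class give the same value, so \<open>the_elem\<close> is applied to a
  singleton: every \<open>H z\<close> of this support identifies their character idempotents, hence
  so does \<open>u (supp x)\<close>.\<close>

lemma e_char_class:
  "e_char u (char_sim `` {(x, \<phi>)}) = u (supp x) \<star> Q_char u (x, \<phi>)"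
proof -
  have "u (supp (fst p)) \<star> Q_char u p = u (supp x) \<star> Q_char u (x, \<phi>)"
    if "((x, \<phi>), p) \<in> char_sim" for p
  proof -
    obtain y \<psi> where p: "p = (y, \<psi>)" by (cases p)
    have y: "y \<in> Idem" "supp x = supp y" "\<psi> \<in> characters y"
      using that by (auto simp: p char_sim_iff)
    have "u (supp x) \<star> E_char (x, \<phi>) = u (supp x) \<star> E_char (y, \<psi>)"
      using H_star_E_char_cong that unfolding p
      by (intro homogeneous_section_star_cong supp_in_Idem_supp x)
    then show ?thesis
      by (simp add: Q_char_eq[OF x \<phi>] Q_char_eq[OF y(1,3)] p y(2)[symmetric] star_assoc[symmetric])
  qed
  moreover have "((x, \<phi>), (x, \<phi>)) \<in> char_sim"
    using x \<phi> by (simp add: char_sim_iff max_subgroup_left_unit)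
  ultimately have "(\<lambda>p. u (supp (fst p)) \<star> Q_char u p) ` (char_sim `` {(x, \<phi>)})
      = {u (supp x) \<star> Q_char u (x, \<phi>)}"
    by (intro equalityI subsetI) (auto intro!: image_eqI[where x = "(x, \<phi>)"])
  then show ?thesis by (simp add: e_char_def)
qed

section \<open>Orthogonality and primitivity of the elements
  \<open>u (supp x) \<star> Q_char u (x, \<phi>)\<close>\<close>

lemma section_Q_char_annihilated_above:
  "annihilated_above (supp x) (u (supp x) \<star> Q_char u (x, \<phi>))"
  by (intro annihilated_above_star Q_char_annihilated_above supp_in_Idem_supp x)

lemma section_section_Q_char:
  "u (supp x) \<star> (u (supp x) \<star> Q_char u (x, \<phi>)) = u (supp x) \<star> Q_char u (x, \<phi>)"
  using homogeneous_section_idem[OF hs supp_in_Idem_supp[OF x]] by (simp add: star_assoc[symmetric])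

end

text \<open>\<open>Q_char u (x, \<phi>)\<close> ends in \<open>e_circ u (supp x)\<close>. This kills
  the second factor, which is fixed by \<open>u (supp y)\<close> and annihilated above
  \<open>supp y\<close>.\<close>

lemma section_Q_char_orthogonal:
  assumes "x \<in> Idem" "\<phi> \<in> characters x" "y \<in> Idem" "\<psi> \<in> characters y" "supp x \<noteq> supp y"
  shows "u (supp x) \<star> Q_char u (x, \<phi>) \<star> (u (supp y) \<star> Q_char u (y, \<psi>)) = 0"
proof -
  have "e_circ u (supp x) \<star> (u (supp y) \<star> Q_char u (y, \<psi>)) = 0"
    using assms
    by (intro e_circ_star_different[OF hs, of _ "supp y"] section_Q_char_annihilated_above
        section_section_Q_char supp_in_Idem_supp)
  then show ?thesis by (simp add: Q_char_eq[OF assms(1,2)] star_assoc)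
qed

lemma section_Q_char_star_same:
  assumes "x \<in> Idem" "\<phi> \<in> characters x" "\<psi> \<in> characters x"
  shows "u (supp x) \<star> Q_char u (x, \<phi>) \<star> (u (supp x) \<star> Q_char u (x, \<psi>))
    = (if \<phi> = \<psi> then u (supp x) \<star> Q_char u (x, \<phi>) else 0)"
proof -
  let ?E = "E_char (x, \<phi>)"
  have "Q_char u (x, \<phi>) \<star> (u (supp x) \<star> Q_char u (x, \<psi>)) = ?E \<star> (u (supp x) \<star> Q_char u (x, \<psi>))"
    using assms by (intro Q_char_star section_Q_char_annihilated_above)
  also have "\<dots> = ?E \<star> E_char (x, \<psi>) \<star> e_circ u (supp x)"
    unfolding Q_char_eq[OF assms(1,3)]
    by (simp only: star_assoc[symmetric] E_char_star_homogeneous_section[OF assms(1,2)])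
  also have "\<dots> = (if \<phi> = \<psi> then Q_char u (x, \<phi>) else 0)"
    using E_char_idem[OF assms(1,2)] E_char_orthogonal[OF assms] assms by (auto simp: Q_char_eq)
  finally show ?thesis by (simp add: star_assoc)
qed

lemma primitive_section_Q_char:
  assumes "x \<in> Idem" "\<phi> \<in> characters x"
  shows "primitive_idempotent (u (supp x) \<star> Q_char u (x, \<phi>))"
proof (rule primitive_idempotentI)
  let ?Q = "Q_char u (x, \<phi>)"
  \<comment> \<open>Left multiplication by \<open>H x\<close> undoes the factor
    \<open>u (supp x)\<close>, which gives nonvanishing.\<close>
  have "H x \<star> (u (supp x) \<star> ?Q) = ?Q"
    using assms
    by (simp add: star_assoc[symmetric] H_Idem_star_homogeneous_section Q_char_eq E_char_unit)
  then show "u (supp x) \<star> ?Q \<noteq> 0" using Q_char_nonzero[OF assms] by auto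
  show "u (supp x) \<star> ?Q \<star> (u (supp x) \<star> ?Q) = u (supp x) \<star> ?Q"
    using section_Q_char_star_same[OF assms assms(2)] by simp
  fix a
  \<comment> \<open>The corner at \<open>a\<close> is inherited from the corner of
    \<open>Q_char\<close> at \<open>a \<star> u (supp x)\<close>.\<close>
  obtain c where c: "?Q \<star> (a \<star> u (supp x)) \<star> ?Q = c *s ?Q" using Q_char_corner[OF assms] by blast
  have "u (supp x) \<star> ?Q \<star> a \<star> (u (supp x) \<star> ?Q) = u (supp x) \<star> (?Q \<star> (a \<star> u (supp x)) \<star> ?Q)"
    by (simp only: star_assoc)
  then show "\<exists>c. u (supp x) \<star> ?Q \<star> a \<star> (u (supp x) \<star> ?Q) = c *s (u (supp x) \<star> ?Q)"
    unfolding c by (auto simp: star_scale_right)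
qed

text \<open>Right multiplication by \<open>e_circ u (supp x)\<close> isolates the characters at
  idempotents of this support. Entries in the group at \<open>x\<close> then isolate
  \<open>x\<close>, as maximal subgroups are disjoint, and \<open>E_char (x, \<phi>)\<close> finally
  isolates \<open>\<phi>\<close>.\<close>

lemma Q_char_independent:
  assumes sum: "(\<Sum>i\<in>S_hat. c i *s Q_char u i) = 0" and i: "(x, \<phi>) \<in> S_hat"
  shows "c (x, \<phi>) = 0"
proof -
  have x: "x \<in> Idem" and \<phi>: "\<phi> \<in> characters x" using i by (auto simp: S_hat_def)
  define v where "v = (\<Sum>\<psi>\<in>characters x. c (x, \<psi>) *s E_char (x, \<psi>))"
  have "v $ s = 0" for s
  proof (cases "s \<in> max_subgroup x")
    case True
    then have s: "omega s = x" by (simp add: max_subgroup_iff)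
    have "0 = ((\<Sum>i\<in>S_hat. c i *s Q_char u i) \<star> e_circ u (supp x)) $ s" by (simp add: sum)
    also have "\<dots> = (\<Sum>i\<in>S_hat. c i * (Q_char u i \<star> e_circ u (supp x)) $ s)"
      by (simp add: star_sum_left star_scale_left sum_component)
    also have "\<dots> = (\<Sum>y\<in>Idem. \<Sum>\<psi>\<in>characters y. c (y, \<psi>) * (Q_char u (y, \<psi>) \<star> e_circ u (supp x)) $ s)"
      unfolding S_hat_def by (subst sum.Sigma) (auto intro: finite_characters)
    also have "\<dots> = (\<Sum>y\<in>Idem. if y = x then \<Sum>\<psi>\<in>characters y. c (y, \<psi>) * E_char (y, \<psi>) $ s else 0)"
    proof (intro sum.cong refl)
      fix y :: 'a assume y: "y \<in> Idem"
      have "(Q_char u (y, \<psi>) \<star> e_circ u (supp x)) $ s = (if y = x then E_char (y, \<psi>) $ s else 0)"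
        if \<psi>: "\<psi> \<in> characters y" for \<psi>
        using Q_char_star_e_circ[OF y \<psi> supp_in_Idem_supp[OF x]] Q_char_nth[OF y \<psi>, of s] s
        by (auto simp: level_def E_char_nth max_subgroup_iff)
      then show "(\<Sum>\<psi>\<in>characters y. c (y, \<psi>) * (Q_char u (y, \<psi>) \<star> e_circ u (supp x)) $ s)
          = (if y = x then \<Sum>\<psi>\<in>characters y. c (y, \<psi>) * E_char (y, \<psi>) $ s else 0)"
        by simp
    qed
    also have "\<dots> = v $ s" using x by (simp add: v_def sum_component)
    finally show ?thesis by simp
  qed (simp add: v_def sum_component E_char_nth)
  then have "v = 0" by (simp add: vec_eq_iff)
  then have "0 = E_char (x, \<phi>) \<star> v" by simp
  also have "\<dots> = (\<Sum>\<psi>\<in>characters x. if \<psi> = \<phi> then c (x, \<phi>) *s E_char (x, \<phi>) else 0)"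
    unfolding v_def star_sum_right star_scale_right
    using E_char_idem[OF x \<phi>] E_char_orthogonal[OF x \<phi>] by (intro sum.cong) auto
  also have "\<dots> = c (x, \<phi>) *s E_char (x, \<phi>)" using finite_characters[OF x] \<phi> by simp
  finally show ?thesis using E_char_nonzero[OF x \<phi>] by simp
qed

end

section \<open>Spanning, and the sum over the characters at one idempotent\<close>

context
  fixes u :: "'a::left_regular_band_of_abelian_groups set \<Rightarrow> 'a alg"
  assumes hs: "homogeneous_section u"
begin

text \<open>\<open>H t\<close> absorbs \<open>H (omega t)\<close> on its left, which is the sum of
  the character idempotents at \<open>omega t\<close>; each of these evaluates \<open>H t\<close> to
  a scalar.\<close>

lemma H_star_e_circ_in_span_level:
  assumes "level t = Y"
  shows "H t \<star> e_circ u Y \<in> vec.span (Q_char u ` S_hat)"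
proof -
  let ?x = "omega t"
  have x: "?x \<in> Idem" and t: "t \<in> max_subgroup ?x" and Y: "Y = supp ?x"
    using assms by (simp_all add: max_subgroup_iff level_def)
  have "H t \<star> e_circ u Y = H ?x \<star> H t \<star> e_circ u Y" by (simp add: H_star_H omega_mult_self)
  also have "\<dots> = (\<Sum>\<phi>\<in>characters ?x. E_char (?x, \<phi>)) \<star> H t \<star> e_circ u Y" by (simp add: sum_E_char[OF x])
  also have "\<dots> = (\<Sum>\<phi>\<in>characters ?x. \<phi> t *s Q_char u (?x, \<phi>))"
    unfolding star_sum_left Y
    using x t by (intro sum.cong) (auto simp: E_char_star_H star_scale_left Q_char_eq)
  also have "\<dots> \<in> vec.span (Q_char u ` S_hat)"
    using x by (intro vec.span_sum vec.span_scale vec.span_base) (auto simp: S_hat_def)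
  finally show ?thesis .
qed

lemma H_star_e_circ_in_span:
  assumes Y: "Y \<in> Idem_supp"
  shows "H s \<star> e_circ u Y \<in> vec.span (Q_char u ` S_hat)"
proof (cases "supp_le (level s) Y")
  case False
  then have "H s \<star> e_circ u Y = 0"
    using e_circ_annihilated_above[OF hs Y] by (simp add: annihilated_above_def)
  then show ?thesis by (simp add: vec.span_zero)
next
  case True
  \<comment> \<open>Inserting \<open>u Y\<close> raises the level: if \<open>supp y = Y\<close> is
    above the level of \<open>s\<close>, then \<open>s * y\<close> has level exactly
    \<open>Y\<close>.\<close>
  have "H s \<star> e_circ u Y = H s \<star> (u Y \<star> e_circ u Y)"
    by (simp add: homogeneous_section_star_e_circ[OF hs Y])
  also have "\<dots> = (\<Sum>y\<in>UNIV. u Y $ y *s (H (s * y) \<star> e_circ u Y))"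
    unfolding star_H_expansion_left[of "u Y"]
    by (simp add: star_sum_right star_scale_right star_assoc[symmetric] H_star_H)
  also have "\<dots> \<in> vec.span (Q_char u ` S_hat)"
  proof (rule vec.span_sum)
    fix y
    show "u Y $ y *s (H (s * y) \<star> e_circ u Y) \<in> vec.span (Q_char u ` S_hat)"
    proof (cases "u Y $ y = 0")
      case False
      then have y: "y \<in> Idem" "supp y = Y" using homogeneous_section_nth[OF hs Y] by auto
      have "y * omega s = y" using True y by (auto simp: level_def supp_le_Idem_iff)
      then have "supp (omega s * y) = supp y"
        using y(1) by (simp add: supp_Idem_eq_iff Idem_mult mult.assoc Idem_mult_self) (simp add: mult.assoc[symmetric] Idem_mult_self)
      then have "level (s * y) = Y" using y by (simp add: level_mult omega_Idem)
      then show ?thesis by (intro vec.span_scale H_star_e_circ_in_span_level)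
    qed (simp add: vec.span_zero)
  qed
  finally show ?thesis .
qed

lemma span_Q_char: "vec.span (Q_char u ` S_hat) = UNIV"
proof -
  have "H s \<in> vec.span (Q_char u ` S_hat)" for s
    using H_star_e_circ_in_span vec.span_sum[of Idem_supp "\<lambda>Y. H s \<star> e_circ u Y" "Q_char u ` S_hat"]
      star_sum_e_circ[OF hs, of "H s"] by (simp add: star_sum_right)
  then have "f \<in> vec.span (Q_char u ` S_hat)" for f
    by (subst alg_expansion[of f]) (intro vec.span_sum vec.span_scale)
  then show ?thesis by blast
qed

lemma sum_section_Q_char:
  assumes "x \<in> Idem"
  shows "(\<Sum>\<phi>\<in>characters x. u (supp x) \<star> Q_char u (x, \<phi>)) = e_circ u (supp x)"
proof -
  have "(\<Sum>\<phi>\<in>characters x. u (supp x) \<star> Q_char u (x, \<phi>))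
      = u (supp x) \<star> ((\<Sum>\<phi>\<in>characters x. E_char (x, \<phi>)) \<star> e_circ u (supp x))"
    unfolding star_sum_left star_sum_right
    using assms by (intro sum.cong) (auto simp: Q_char_eq)
  also have "\<dots> = u (supp x) \<star> e_circ u (supp x)"
    by (simp add: sum_E_char[OF assms] star_assoc[symmetric] homogeneous_section_star_H[OF hs assms])
  finally show ?thesis using homogeneous_section_star_e_circ[OF hs supp_in_Idem_supp[OF assms]] by simp
qed

end

text \<open>\<open>r\<close> picks one idempotent per support, and a class contains exactly one
  character there. Equivalent characters at the same idempotent agree because it is the unit of its
  group; existence is \<open>character_pullback\<close>.\<close>

lemma T_hat_bij:
  fixes r :: "'a::left_regular_band_of_groups set \<Rightarrow> 'a"
  assumes r: "\<And>X. X \<in> Idem_supp \<Longrightarrow> r X \<in> Idem \<and> supp (r X) = X"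
  shows "bij_betw (\<lambda>(X, \<phi>). char_sim `` {(r X, \<phi>)}) (Sigma Idem_supp (\<lambda>X. characters (r X))) T_hat"
proof (rule bij_betw_imageI)
  show "inj_on (\<lambda>(X, \<phi>). char_sim `` {(r X, \<phi>)}) (Sigma Idem_supp (\<lambda>X. characters (r X)))"
  proof (rule inj_onI, clarify)
    fix X Y \<phi> \<psi>
    assume h: "X \<in> Idem_supp" "\<phi> \<in> characters (r X)" "Y \<in> Idem_supp" "\<psi> \<in> characters (r Y)"
      and eq: "char_sim `` {(r X, \<phi>)} = char_sim `` {(r Y, \<psi>)}"
    have "((r X, \<phi>), (r Y, \<psi>)) \<in> char_sim"
      using eq_equiv_class[OF eq equiv_char_sim] h r by (simp add: S_hat_def)
    then have XY: "X = Y" and "\<forall>s\<in>max_subgroup (r X). \<phi> s = \<psi> (r Y * s)"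
      using h r by (metis char_sim_iff)+
    then have "\<forall>s\<in>max_subgroup (r X). \<phi> s = \<psi> s" using max_subgroup_left_unit by metis
    moreover have "\<phi> \<in> extensional (max_subgroup (r X))" "\<psi> \<in> extensional (max_subgroup (r X))"
      using h XY by (simp_all add: characters_def PiE_iff)
    ultimately show "X = Y \<and> \<phi> = \<psi>" using XY by (auto intro: extensionalityI)
  qed
  show "(\<lambda>(X, \<phi>). char_sim `` {(r X, \<phi>)}) ` Sigma Idem_supp (\<lambda>X. characters (r X)) = T_hat"
  proof (intro equalityI subsetI)
    fix \<Phi> assume "\<Phi> \<in> (\<lambda>(X, \<phi>). char_sim `` {(r X, \<phi>)}) ` Sigma Idem_supp (\<lambda>X. characters (r X))"
    then show "\<Phi> \<in> T_hat" using r by (auto simp: T_hat_def S_hat_def intro!: quotientI)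
  next
    fix \<Phi> :: "('a \<times> ('a \<Rightarrow> complex)) set" assume "\<Phi> \<in> T_hat"
    then obtain y \<psi> where y: "y \<in> Idem" "\<psi> \<in> characters y" "\<Phi> = char_sim `` {(y, \<psi>)}"
      unfolding T_hat_def S_hat_def by (auto elim!: quotientE)
    define X where "X = supp y"
    have X: "X \<in> Idem_supp" using y by (simp add: X_def supp_in_Idem_supp)
    let ?\<phi> = "restrict (\<lambda>s. \<psi> (y * s)) (max_subgroup (r X))"
    have sim: "((r X, ?\<phi>), (y, \<psi>)) \<in> char_sim"
      using r[OF X] y by (intro character_pullback) (auto simp: X_def)
    then have "?\<phi> \<in> characters (r X)" by (simp add: char_sim_iff)
    moreover have "\<Phi> = char_sim `` {(r X, ?\<phi>)}"
      using equiv_class_eq[OF equiv_char_sim sim] y(3) by simp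
    ultimately show "\<Phi> \<in> (\<lambda>(X, \<phi>). char_sim `` {(r X, \<phi>)}) ` Sigma Idem_supp (\<lambda>X. characters (r X))"
      using X by (intro image_eqI[where x = "(X, ?\<phi>)"]) auto
  qed
qed

lemma complete_e_char:
  fixes u :: "'a::left_regular_band_of_abelian_groups set \<Rightarrow> 'a alg"
  assumes hs: "homogeneous_section u"
  shows "complete_primitive_orthogonal T_hat (e_char u)"
proof -
  obtain r :: "'a set \<Rightarrow> 'a" where r: "\<And>X. X \<in> Idem_supp \<Longrightarrow> r X \<in> Idem \<and> supp (r X) = X"
    using Idem_suppE by metis
  let ?I = "Sigma Idem_supp (\<lambda>X. characters (r X))"
  let ?class = "\<lambda>(X, \<phi>). char_sim `` {(r X, \<phi>)}"
  note bij = T_hat_bij[of r, OF r]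
  have e: "e_char u (?class (X, \<phi>)) = u X \<star> Q_char u (r X, \<phi>)"
    if "X \<in> Idem_supp" "\<phi> \<in> characters (r X)" for X \<phi>
    using e_char_class[OF hs, of "r X" \<phi>] r that by simp
  have T_hatE: "\<exists>X \<phi>. X \<in> Idem_supp \<and> \<phi> \<in> characters (r X) \<and> \<Phi> = ?class (X, \<phi>)" if "\<Phi> \<in> T_hat" for \<Phi>
  proof -
    have "\<Phi> \<in> ?class ` ?I" using that by (simp only: bij_betw_imp_surj_on[OF bij])
    then obtain p where p: "\<Phi> = ?class p" "p \<in> ?I" by (rule imageE)
    obtain X \<phi> where "p = (X, \<phi>)" by (cases p)
    then show ?thesis using p by (intro exI[of _ X] exI[of _ \<phi>]) simp
  qed
  have "primitive_idempotent (e_char u \<Phi>)" if \<Phi>: "\<Phi> \<in> T_hat" for \<Phi>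
  proof -
    obtain X \<phi> where "X \<in> Idem_supp" "\<phi> \<in> characters (r X)" "\<Phi> = ?class (X, \<phi>)" using T_hatE[OF \<Phi>] by blast
    then show ?thesis using primitive_section_Q_char[OF hs, of "r X" \<phi>] r[of X] e[of X \<phi>] by simp
  qed
  moreover have "e_char u \<Phi> \<star> e_char u \<Psi> = 0" if \<Phi>\<Psi>: "\<Phi> \<in> T_hat" "\<Psi> \<in> T_hat" "\<Phi> \<noteq> \<Psi>" for \<Phi> \<Psi>
  proof -
    obtain X \<phi> where X: "X \<in> Idem_supp" "\<phi> \<in> characters (r X)" "\<Phi> = ?class (X, \<phi>)" using T_hatE[OF \<Phi>\<Psi>(1)] by blast
    obtain Y \<psi> where Y: "Y \<in> Idem_supp" "\<psi> \<in> characters (r Y)" "\<Psi> = ?class (Y, \<psi>)" using T_hatE[OF \<Phi>\<Psi>(2)] by blast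
    show ?thesis
    proof (cases "X = Y")
      case True
      then have "\<phi> \<noteq> \<psi>" using \<Phi>\<Psi>(3) X Y by auto
      then show ?thesis
        using section_Q_char_star_same[OF hs, of "r X" \<phi> \<psi>] r[of X] e[of X \<phi>] e[of Y \<psi>] X Y True by simp
    next
      case False
      then show ?thesis
        using section_Q_char_orthogonal[OF hs, of "r X" \<phi> "r Y" \<psi>] r[of X] r[of Y] e[of X \<phi>] e[of Y \<psi>] X Y by simp
    qed
  qed
  \<comment> \<open>Grouped by support, the characters at \<open>r X\<close> contribute
    \<open>e_circ u X\<close>, which reduces completeness to \<open>star_sum_e_circ\<close>.\<close>
  moreover have "(\<Sum>\<Phi>\<in>T_hat. e_char u \<Phi>) = (\<Sum>X\<in>Idem_supp. e_circ u X)"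
  proof -
    have "(\<Sum>\<Phi>\<in>T_hat. e_char u \<Phi>) = (\<Sum>p\<in>?I. e_char u (?class p))"
      by (rule sum.reindex_bij_betw[OF bij, symmetric])
    also have "\<dots> = (\<Sum>(X, \<phi>)\<in>?I. u X \<star> Q_char u (r X, \<phi>))"
      using e by (intro sum.cong) auto
    also have "\<dots> = (\<Sum>X\<in>Idem_supp. \<Sum>\<phi>\<in>characters (r X). u X \<star> Q_char u (r X, \<phi>))"
      using r by (intro sum.Sigma[symmetric]) (auto intro: finite_characters)
    also have "\<dots> = (\<Sum>X\<in>Idem_supp. e_circ u X)"
      using sum_section_Q_char[OF hs] r by (intro sum.cong) (metis, metis)
    finally show ?thesis .
  qed
  ultimately show ?thesis
    using star_sum_e_circ[OF hs] by (simp add: complete_primitive_orthogonal_def)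
qed

theorem theorem4p10:
  fixes u :: "'a::left_regular_band_of_abelian_groups set \<Rightarrow> 'a alg"
  assumes "homogeneous_section u"
  shows "is_basis_family S_hat (Q_char u)
    \<and> (\<forall>\<phi>\<in>S_hat. primitive_idempotent (Q_char u \<phi>))
    \<and> complete_primitive_orthogonal T_hat (e_char u)"
proof (intro conjI ballI)
  show "is_basis_family S_hat (Q_char u)"
  proof (rule is_basis_familyI[OF finite_S_hat _ span_Q_char[OF assms]])
    fix c and i :: "'a \<times> ('a \<Rightarrow> complex)"
    assume "(\<Sum>j\<in>S_hat. c j *s Q_char u j) = 0" "i \<in> S_hat"
    then show "c i = 0" using Q_char_independent[OF assms, of c "fst i" "snd i"] by simp
  qed
  show "primitive_idempotent (Q_char u \<phi>)" if "\<phi> \<in> S_hat" for \<phi>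
    using that primitive_Q_char[OF assms] by (auto simp: S_hat_def)
  show "complete_primitive_orthogonal T_hat (e_char u)"
    using assms by (rule complete_e_char)
qed

end
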